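(* Let $a$ be a positive integer and $k\ge0$ an integer, and define $$CM_{a^k} = \sum_\lambda (-1)^{|\lambda|} \binom{n_a(\lambda) + k}{k}\, m_{\lambda + (a^k)}\, e_\lambda^\perp ,$$ the sum over all partitions $\lambda$. Then $CM_{a^k} m_\lambda = m_{\lambda + a^k}$ for every partition $\lambda$, with the convention that $m_{\lambda + a^k} = 0$ if $l(\lambda)>k$.
   Context: $m_\lambda$, $e_\lambda$ are the monomial and elementary symmetric functions; $g^\perp$ is the adjoint of multiplication by $g$ with respect to the Hall inner product. $n_a(\lambda)$ is the number of parts of $\lambda$ equal to $a$. $\lambda+(a^k)$ denotes the partition obtained from $\lambda$ by inserting $k$ parts equal to $a$, while $\lambda+a^k$ (for $l(\lambda)\le k$) denotes $(\lambda_1+a,\ldots,\lambda_k+a)$ with $\lambda_i=0$ for $i>l(\lambda)$, i.e. $\lambda$ with $a$ columns of height $k$ added. *)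

theory Defs
  imports Complex_Main "HOL-Library.Multiset"
begin

section \<open>The ring of symmetric functions\<close>

text \<open>
  A monomial in the variables \<open>x\<^sub>0, x\<^sub>1, \<dots>\<close> is the multiset of the indices of its variables:
  \<^term>\<open>count M i\<close> is the exponent of \<open>x\<^sub>i\<close>, the product of monomials is \<^term>\<open>M + N\<close>, and the
  total degree is \<^term>\<open>size M\<close>.  A symmetric function is a formal power series of bounded degree,
  given by its coefficients, that is invariant under all permutations of the variables.
\<close>

definition symmetric_series :: "(nat multiset \<Rightarrow> 'a :: zero) \<Rightarrow> bool" where
  "symmetric_series f \<longleftrightarrow>
     (\<exists>d. \<forall>M. f M \<noteq> 0 \<longrightarrow> size M \<le> d) \<and>
     (\<forall>\<pi> M. bij \<pi> \<longrightarrow> f (image_mset \<pi> M) = f M)"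

lemma symmetric_seriesI:
  assumes "\<And>M. f M \<noteq> 0 \<Longrightarrow> size M \<le> d"
    and "\<And>\<pi> M. bij \<pi> \<Longrightarrow> f (image_mset \<pi> M) = f M"
  shows "symmetric_series f"
  using assms unfolding symmetric_series_def by blast

lemma symmetric_series_bounded:
  assumes "symmetric_series f"
  obtains d where "\<And>M. f M \<noteq> 0 \<Longrightarrow> size M \<le> d"
  using assms unfolding symmetric_series_def by blast

lemma symmetric_series_image_mset:
  "symmetric_series f \<Longrightarrow> bij \<pi> \<Longrightarrow> f (image_mset \<pi> M) = f M"
  unfolding symmetric_series_def by blast

typedef (overloaded) 'a symfun = "{f :: nat multiset \<Rightarrow> 'a :: comm_ring_1. symmetric_series f}"
  morphisms coeff Abs_symfun
  by (rule exI[of _ "\<lambda>_. 0"]) (simp add: symmetric_series_def)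

setup_lifting type_definition_symfun

lemma symfun_eqI: "(\<And>M. coeff f M = coeff g M) \<Longrightarrow> f = g"
  by (metis coeff_inject ext)

lemma finite_submultisets: "finite {A :: 'b multiset. A \<subseteq># M}"
proof (rule finite_subset)
  show "{A. A \<subseteq># M} \<subseteq> mset ` {xs. set xs \<subseteq> set_mset M \<and> length xs \<le> size M}"
  proof
    fix A assume "A \<in> {A. A \<subseteq># M}"
    moreover obtain xs where "A = mset xs" using ex_mset by metis
    ultimately show "A \<in> mset ` {xs. set xs \<subseteq> set_mset M \<and> length xs \<le> size M}"
      using set_mset_mono[of A M] size_mset_mono[of A M] by auto
  qed
qed (simp add: finite_lists_length_le)

lemma finite_msplits: "finite {(A, B). A + B = (M :: 'b multiset)}"
  by (rule finite_subset[of _ "{A. A \<subseteq># M} \<times> {A. A \<subseteq># M}"])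
     (auto simp: finite_submultisets)

instantiation symfun :: (comm_ring_1) comm_ring_1
begin

lift_definition zero_symfun :: "'a symfun" is "\<lambda>_. 0"
  by (simp add: symmetric_series_def)

lift_definition one_symfun :: "'a symfun" is "\<lambda>M. if M = {#} then 1 else 0"
  by (rule symmetric_seriesI[of _ 0]) (auto split: if_splits)

lift_definition plus_symfun :: "'a symfun \<Rightarrow> 'a symfun \<Rightarrow> 'a symfun" is "\<lambda>f g M. f M + g M"
proof -
  fix f g :: "nat multiset \<Rightarrow> 'a"
  assume f: "symmetric_series f" and g: "symmetric_series g"
  obtain d where d: "\<And>M. f M \<noteq> 0 \<Longrightarrow> size M \<le> d"
    using symmetric_series_bounded[OF f] by blast
  obtain e where e: "\<And>M. g M \<noteq> 0 \<Longrightarrow> size M \<le> e"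
    using symmetric_series_bounded[OF g] by blast
  show "symmetric_series (\<lambda>M. f M + g M)"
  proof (rule symmetric_seriesI[of _ "max d e"])
    fix M assume "f M + g M \<noteq> 0"
    then have "f M \<noteq> 0 \<or> g M \<noteq> 0" by auto
    then show "size M \<le> max d e" using d e by (meson max.coboundedI1 max.coboundedI2)
  qed (simp add: symmetric_series_image_mset[OF f] symmetric_series_image_mset[OF g])
qed

lift_definition uminus_symfun :: "'a symfun \<Rightarrow> 'a symfun" is "\<lambda>f M. - f M"
  by (simp add: symmetric_series_def)

definition minus_symfun :: "'a symfun \<Rightarrow> 'a symfun \<Rightarrow> 'a symfun" where
  "minus_symfun f g = f + - g"

lift_definition times_symfun :: "'a symfun \<Rightarrow> 'a symfun \<Rightarrow> 'a symfun" is
  "\<lambda>f g M. \<Sum>(A, B) \<in> {(A, B). A + B = M}. f A * g B"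
proof -
  fix f g :: "nat multiset \<Rightarrow> 'a"
  assume f: "symmetric_series f" and g: "symmetric_series g"
  obtain d where d: "\<And>M. f M \<noteq> 0 \<Longrightarrow> size M \<le> d"
    using symmetric_series_bounded[OF f] by blast
  obtain e where e: "\<And>M. g M \<noteq> 0 \<Longrightarrow> size M \<le> e"
    using symmetric_series_bounded[OF g] by blast
  show "symmetric_series (\<lambda>M. \<Sum>(A, B) \<in> {(A, B). A + B = M}. f A * g B)"
  proof (rule symmetric_seriesI[of _ "d + e"])
    fix M assume "(\<Sum>(A, B) \<in> {(A, B). A + B = M}. f A * g B) \<noteq> 0"
    then obtain p where "p \<in> {(A, B). A + B = M}" "(case p of (A, B) \<Rightarrow> f A * g B) \<noteq> 0"
      by (rule sum.not_neutral_contains_not_neutral)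
    then obtain A B where AB: "A + B = M" "f A * g B \<noteq> 0" by auto
    then have "f A \<noteq> 0" "g B \<noteq> 0" by auto
    with d e have "size A \<le> d" "size B \<le> e" by blast+
    then show "size M \<le> d + e" using AB(1) by auto
  next
    fix \<pi> :: "nat \<Rightarrow> nat" and M
    assume \<pi>: "bij \<pi>"
    have 1: "inv \<pi> \<circ> \<pi> = id" "\<pi> \<circ> inv \<pi> = id"
      using \<pi> by (auto simp: fun_eq_iff bij_def surj_f_inv_f)
    have 2: "image_mset (inv \<pi>) (image_mset \<pi> A) = A"
        "image_mset \<pi> (image_mset (inv \<pi>) A) = A" for A
      using 1 by (simp_all add: multiset.map_comp)
    show "(\<Sum>(A, B) \<in> {(A, B). A + B = image_mset \<pi> M}. f A * g B) =
          (\<Sum>(A, B) \<in> {(A, B). A + B = M}. f A * g B)"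
    proof (rule sum.reindex_bij_witness[where
          i = "map_prod (image_mset \<pi>) (image_mset \<pi>)" and
          j = "map_prod (image_mset (inv \<pi>)) (image_mset (inv \<pi>))"])
      fix p assume "p \<in> {(A, B). A + B = image_mset \<pi> M}"
      then obtain A B where p: "p = (A, B)" "A + B = image_mset \<pi> M" by auto
      then have "image_mset (inv \<pi>) A + image_mset (inv \<pi>) B = M"
        by (metis 2(1) image_mset_union)
      then show "map_prod (image_mset (inv \<pi>)) (image_mset (inv \<pi>)) p \<in> {(A, B). A + B = M}"
        using p(1) by simp
    qed (auto simp: 2 symmetric_series_image_mset[OF f] symmetric_series_image_mset[OF g]
           bij_imp_bij_inv[OF \<pi>])
  qed
qed

instance
proof
  fix f g h :: "'a symfun"
  show "f + g + h = f + (g + h)"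
    by transfer (simp add: add.assoc)
  show "f + g = g + f"
    by transfer (simp add: add.commute)
  show "0 + f = f"
    by transfer simp
  show "- f + f = 0"
    by transfer simp
  show "f - g = f + - g"
    by (simp add: minus_symfun_def)
  show "(0 :: 'a symfun) \<noteq> 1"
    by transfer (metis zero_neq_one)
  show "(f + g) * h = f * h + g * h"
    by transfer (simp add: fun_eq_iff distrib_right sum.distrib case_prod_unfold)
  show "f * g = g * f"
    by transfer
      (auto simp: fun_eq_iff mult.commute add.commute
        intro!: sum.reindex_bij_witness[where i = prod.swap and j = prod.swap])
  show "1 * f = f"
  proof (rule symfun_eqI)
    fix M
    have "coeff (1 * f) M =
      (\<Sum>(A, B) \<in> {(A, B). A + B = M}. (if A = {#} then 1 else 0) * coeff f B)"
      by (simp add: times_symfun.rep_eq one_symfun.rep_eq)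
    also have "\<dots> = (\<Sum>(A, B) \<in> {({#} :: nat multiset, M)}. (if A = {#} then 1 else 0) * coeff f B)"
      by (intro sum.mono_neutral_right) (auto simp: finite_msplits split: if_splits)
    finally show "coeff (1 * f) M = coeff f M" by simp
  qed
  show "f * g * h = f * (g * h)"
  proof (rule symfun_eqI)
    fix M
    have "coeff (f * g * h) M =
      (\<Sum>p \<in> {(X, C). X + C = M}. \<Sum>q \<in> {(A, B). A + B = fst p}.
         coeff f (fst q) * coeff g (snd q) * coeff h (snd p))"
      by (simp add: times_symfun.rep_eq case_prod_unfold sum_distrib_right)
    also have "\<dots> = (\<Sum>(p, q) \<in> (SIGMA p : {(X, C). X + C = M}. {(A, B). A + B = fst p}).
         coeff f (fst q) * coeff g (snd q) * coeff h (snd p))"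
      by (rule sum.Sigma) (use finite_msplits in auto)
    also have "\<dots> = (\<Sum>(p, q) \<in> (SIGMA p : {(A, X). A + X = M}. {(B, C). B + C = snd p}).
         coeff f (fst p) * (coeff g (fst q) * coeff h (snd q)))"
      by (rule sum.reindex_bij_witness[where
            i = "\<lambda>((A, X), (B, C)). ((A + B, C), (A, B))" and
            j = "\<lambda>((X, C), (A, B)). ((A, B + C), (B, C))"])
         (auto simp: add.assoc mult.assoc)
    also have "\<dots> = (\<Sum>p \<in> {(A, X). A + X = M}. \<Sum>q \<in> {(B, C). B + C = snd p}.
         coeff f (fst p) * (coeff g (fst q) * coeff h (snd q)))"
      by (rule sum.Sigma[symmetric]) (use finite_msplits in auto)
    also have "\<dots> = coeff (f * (g * h)) M"
      by (simp add: times_symfun.rep_eq case_prod_unfold sum_distrib_left)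
    finally show "coeff (f * g * h) M = coeff (f * (g * h)) M" .
  qed
qed

end

lift_definition symfun_scale :: "'a :: comm_ring_1 \<Rightarrow> 'a symfun \<Rightarrow> 'a symfun" is "\<lambda>c f M. c * f M"
  unfolding symmetric_series_def by (metis mult_zero_right)

global_interpretation symfun: vector_space "symfun_scale :: 'a :: field \<Rightarrow> 'a symfun \<Rightarrow> 'a symfun"
  by unfold_locales (transfer; simp add: fun_eq_iff algebra_simps)+


section \<open>Partitions\<close>

text \<open>
  A partition is the multiset of its (positive) parts.  Hence \<open>n\<^sub>a(\<nu>)\<close> is \<^term>\<open>count \<nu> a\<close>,
  \<open>l(\<nu>)\<close> is \<^term>\<open>size \<nu>\<close>, and \<open>\<bar>\<nu>\<bar>\<close> is \<^term>\<open>sum_mset \<nu>\<close>.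
\<close>

definition is_partition :: "nat multiset \<Rightarrow> bool" where
  "is_partition \<nu> \<longleftrightarrow> 0 \<notin># \<nu>"

definition insert_parts :: "nat \<Rightarrow> nat \<Rightarrow> nat multiset \<Rightarrow> nat multiset" where
  "insert_parts a k \<nu> = \<nu> + replicate_mset k a"

text \<open>
  Meaningful only if \<^term>\<open>size \<nu> \<le> k\<close>: \<open>\<nu>\<close> is padded with zeros to \<open>k\<close> parts before \<open>a\<close> is added to
  each of them.
\<close>

definition add_columns :: "nat \<Rightarrow> nat \<Rightarrow> nat multiset \<Rightarrow> nat multiset" where
  "add_columns a k \<nu> = image_mset (\<lambda>i. i + a) (\<nu> + replicate_mset (k - size \<nu>) 0)"


section \<open>Monomial, elementary and complete symmetric functions\<close>

definition exponents :: "nat multiset \<Rightarrow> nat multiset" where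
  "exponents M = image_mset (count M) (mset_set (set_mset M))"

lemma size_eq_sum_exponents: "size M = sum_mset (exponents M)"
  by (simp add: exponents_def size_multiset_overloaded_eq sum_unfold_sum_mset)

lemma count_image_mset_inj:
  assumes "inj \<pi>"
  shows "count (image_mset \<pi> M) (\<pi> x) = count M x"
  by (induction M) (auto simp: inj_eq[OF assms])

lemma exponents_image_mset:
  assumes "bij \<pi>"
  shows "exponents (image_mset \<pi> M) = exponents M"
proof -
  have inj: "inj \<pi>" using assms by (rule bij_is_inj)
  have "mset_set (\<pi> ` set_mset M) = image_mset \<pi> (mset_set (set_mset M))"
    using inj by (simp add: image_mset_mset_set inj_on_subset)
  moreover have "count (image_mset \<pi> M) (\<pi> x) = count M x" for x
    using count_image_mset_inj[OF inj] by simp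
  ultimately show ?thesis
    by (simp add: exponents_def multiset.map_comp comp_def)
qed

lift_definition monomial_sym :: "nat multiset \<Rightarrow> 'a :: comm_ring_1 symfun" is
  "\<lambda>\<nu> M. if exponents M = \<nu> then 1 else 0"
  subgoal for \<nu>
    by (rule symmetric_seriesI[of _ "sum_mset \<nu>"])
       (auto simp: exponents_image_mset size_eq_sum_exponents split: if_splits)
  done

lift_definition elementary_sym :: "nat \<Rightarrow> 'a :: comm_ring_1 symfun" is
  "\<lambda>n M. if size M = n \<and> (\<forall>i. count M i \<le> 1) then 1 else 0"
proof -
  fix n :: nat
  show "symmetric_series (\<lambda>M. if size M = n \<and> (\<forall>i. count M i \<le> 1) then 1 else (0 :: 'a))"
  proof (rule symmetric_seriesI[of _ n])
    fix \<pi> :: "nat \<Rightarrow> nat" and M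
    assume \<pi>: "bij \<pi>"
    have "(\<forall>i. count (image_mset \<pi> M) i \<le> 1) \<longleftrightarrow> (\<forall>i. count (image_mset \<pi> M) (\<pi> i) \<le> 1)"
      using bij_is_surj[OF \<pi>] by (metis surjD)
    then show "(if size (image_mset \<pi> M) = n \<and> (\<forall>i. count (image_mset \<pi> M) i \<le> 1) then 1 else 0) =
      (if size M = n \<and> (\<forall>i. count M i \<le> 1) then 1 else (0 :: 'a))"
      using count_image_mset_inj[OF bij_is_inj[OF \<pi>]] by simp
  qed (auto split: if_splits)
qed

lift_definition complete_sym :: "nat \<Rightarrow> 'a :: comm_ring_1 symfun" is
  "\<lambda>n M. if size M = n then 1 else 0"
  subgoal for n by (rule symmetric_seriesI[of _ n]) (auto split: if_splits)
  done

definition elementary_part :: "nat multiset \<Rightarrow> 'a :: comm_ring_1 symfun" where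
  "elementary_part \<nu> = (\<Prod>i \<in># \<nu>. elementary_sym i)"

definition complete_part :: "nat multiset \<Rightarrow> 'a :: comm_ring_1 symfun" where
  "complete_part \<nu> = (\<Prod>i \<in># \<nu>. complete_sym i)"


section \<open>The Hall inner product and adjoints\<close>

text \<open>
  The Hall inner product is the bilinear form for which the bases \<open>(m\<^sub>\<nu>)\<close> and \<open>(h\<^sub>\<nu>)\<close> are dual to
  each other.
\<close>

definition is_hall_form :: "('a :: field_char_0 symfun \<Rightarrow> 'a symfun \<Rightarrow> 'a) \<Rightarrow> bool" where
  "is_hall_form B \<longleftrightarrow>
     (\<forall>g. Vector_Spaces.linear symfun_scale (*) (\<lambda>f. B f g)) \<and>
     (\<forall>f. Vector_Spaces.linear symfun_scale (*) (\<lambda>g. B f g)) \<and>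
     (\<forall>\<nu> \<mu>. is_partition \<nu> \<longrightarrow> is_partition \<mu> \<longrightarrow>
        B (monomial_sym \<nu>) (complete_part \<mu>) = (if \<nu> = \<mu> then 1 else 0))"

definition hall :: "'a :: field_char_0 symfun \<Rightarrow> 'a symfun \<Rightarrow> 'a" where
  "hall = (THE B. is_hall_form B)"

definition perp :: "'a :: field_char_0 symfun \<Rightarrow> 'a symfun \<Rightarrow> 'a symfun" where
  "perp g f = (THE u. \<forall>v. hall u v = hall f (g * v))"


section \<open>The operators adding columns\<close>

definition CM_term :: "nat \<Rightarrow> nat \<Rightarrow> nat multiset \<Rightarrow> 'a :: field_char_0 symfun \<Rightarrow> 'a symfun" where
  "CM_term a k \<mu> f =
     (- 1) ^ sum_mset \<mu> * of_nat ((count \<mu> a + k) choose k) *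
       monomial_sym (insert_parts a k \<mu>) * perp (elementary_part \<mu>) f"

text \<open>
  The sum over all partitions is meaningful because only finitely many terms are nonzero.  As a sum over
  an infinite set is \<open>0\<close> by convention, a statement about \<open>CM\<close> is only informative together with this
  finiteness.
\<close>

definition CM :: "nat \<Rightarrow> nat \<Rightarrow> 'a :: field_char_0 symfun \<Rightarrow> 'a symfun" where
  "CM a k f = (\<Sum>\<mu> | is_partition \<mu> \<and> CM_term a k \<mu> f \<noteq> 0. CM_term a k \<mu> f)"

end

theory Submission
  imports Defs "HOL-Combinatorics.Permutations"
begin

text \<open>
  In plethystic notation \<open>\<Sum>\<^sub>\<mu> (-1)\<^bsup>|\<mu>|\<^esup> m\<^sub>\<mu>(Y) e\<^sub>\<mu>\<^sup>\<bottom> f = f[X - Y]\<close>, because \<open>h\<^sub>n\<^sup>\<bottom>\<close> extracts the coefficient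
  of the \<open>n\<close>-th power of an additional variable and \<open>E(-t) H(t) = 1\<close>.  The binomial coefficient counts the
  sets \<open>S\<close> of \<open>k\<close> variables with exponent \<open>a\<close> in a monomial of \<open>m\<^bsub>\<mu>+(a\<^sup>k)\<^esub>\<close>.  Hence \<open>CM f\<close> is the sum over
  all \<open>k\<close>-element sets \<open>S\<close> of variables of \<open>(\<Prod>S)\<^sup>a f[X - (X - S)] = (\<Prod>S)\<^sup>a f[S]\<close>, and for \<open>f = m\<^sub>\<nu>\<close> this is
  \<open>m\<^bsub>\<nu>+a\<^sup>k\<^esub>\<close>.  The adjoints exist because the \<open>h\<^sub>\<mu>\<close> form a basis in characteristic \<open>0\<close>.
\<close>

section \<open>Exponents and coefficients\<close>

text \<open>\<open>hall\<close> and \<open>perp\<close> are definite descriptions, so nothing can be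
  computed with them before existence and uniqueness are known; this is why the h_\<mu> must be
  shown to be a basis. The bridge to coefficients is that pairing with
  \<open>complete_part (exponents M)\<close> is the functional \<open>coeff _ M\<close>: adjointness
  becomes a check on monomials, and h_n^perp gets an explicit formula. No such formula is derived
  for e_n^perp, which is accessible only through the alternating sums that E(-t) H(t) = 1 provides.
  Both facts needed about it, the drop in degree and the cancellation that sets variables to 0, are
  drawn from these sums. Plethystic substitution is never defined. Coefficients are compared one
  monomial M at a time, with the finite variable set of M in place of X, and the sum over \<mu> is
  cut off at a degree depending on M.\<close>

lemma count_exponents: "count (exponents M) n = card {i \<in> set_mset M. count M i = n}"
proof -
  have "count (exponents M) n = (\<Sum>i \<in> {i \<in> set_mset M. count M i = n}. 1)"
    unfolding exponents_def count_image_mset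
    by (intro sum.cong) (auto simp: count_mset_set')
  then show ?thesis by simp
qed

lemma is_partition_exponents [simp]: "is_partition (exponents M)"
  by (auto simp: is_partition_def exponents_def) (metis not_in_iff)

lemma size_exponents: "size (exponents M) = card (set_mset M)"
  by (simp add: exponents_def)

lemma exponents_empty [simp]: "exponents {#} = {#}"
  by (simp add: exponents_def)

lemma exponents_eq_empty_iff [simp]: "exponents M = {#} \<longleftrightarrow> M = {#}"
  by (simp add: exponents_def mset_set_empty_iff)

lemma exponents_plus_disjoint:
  assumes "set_mset M \<inter> set_mset N = {}"
  shows "exponents (M + N) = exponents M + exponents N"
proof -
  have "mset_set (set_mset (M + N)) = mset_set (set_mset M) + mset_set (set_mset N)"
    using assms by (simp add: mset_set_Union)
  moreover have "image_mset (count (M + N)) (mset_set (set_mset M)) = exponents M"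
    unfolding exponents_def using assms
    by (intro image_mset_cong) (auto simp: not_in_iff)
  moreover have "image_mset (count (M + N)) (mset_set (set_mset N)) = exponents N"
    unfolding exponents_def using assms
    by (intro image_mset_cong) (auto simp: not_in_iff)
  ultimately show ?thesis by (simp add: exponents_def[of "M + N"])
qed

lemma exponents_replicate: "n > 0 \<Longrightarrow> exponents (replicate_mset n j) = {#n#}"
  by (simp add: exponents_def)

lemma exponents_plus_replicate:
  assumes "j \<notin># M" and "n > 0"
  shows "exponents (M + replicate_mset n j) = add_mset n (exponents M)"
  using assms by (subst exponents_plus_disjoint) (auto simp: exponents_replicate)

lemma exponents_surj:
  assumes "is_partition \<nu>"
  obtains M where "exponents M = \<nu>"
proof -
  have "is_partition \<nu> \<Longrightarrow> \<exists>M. exponents M = \<nu>"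
  proof (induction \<nu>)
    case empty
    show ?case using exponents_empty by blast
  next
    case (add n \<nu>)
    then obtain M where "exponents M = \<nu>" by (auto simp: is_partition_def)
    moreover obtain j where "j \<notin># M"
      using ex_new_if_finite[OF infinite_UNIV_nat] by blast
    ultimately have "exponents (M + replicate_mset n j) = add_mset n \<nu>"
      using add.prems by (auto simp: exponents_plus_replicate is_partition_def)
    then show ?case by blast
  qed
  then show ?thesis using assms that by blast
qed

text \<open>The zeros stand for variables of \<open>Z\<close> absent from M. This padding allows
  monomials in different variables to be compared, and it is also the padding inside
  \<open>add_columns\<close>.\<close>

lemma image_mset_count_superset:
  assumes "finite Z" and "set_mset M \<subseteq> Z"
  shows "image_mset (count M) (mset_set Z) = exponents M + replicate_mset (card Z - size (exponents M)) 0"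
proof -
  have Z: "Z = set_mset M \<union> (Z - set_mset M)" using assms(2) by blast
  have "mset_set Z = mset_set (set_mset M) + mset_set (Z - set_mset M)"
    by (subst Z, subst mset_set_Union) (use assms(1) in auto)
  moreover have "image_mset (count M) (mset_set (Z - set_mset M)) =
      image_mset (\<lambda>_. 0) (mset_set (Z - set_mset M))"
    using assms(1) by (intro image_mset_cong) (auto simp: not_in_iff)
  moreover have "card (Z - set_mset M) = card Z - size (exponents M)"
    using assms(2) by (simp add: size_exponents card_Diff_subset)
  ultimately show ?thesis
    by (simp add: exponents_def image_mset_const_eq)
qed

text \<open>On a common finite variable set \<open>Z\<close> the exponents of M and N form the same
  multiset, zeros included, so a permutation of \<open>Z\<close> matches them; outside
  \<open>Z\<close> both vanish. Hence a symmetric function has one coefficient per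
  partition.\<close>

lemma exponents_eqE:
  assumes "exponents M = exponents N"
  obtains \<pi> where "bij \<pi>" and "image_mset \<pi> M = N"
proof -
  define Z where "Z = set_mset M \<union> set_mset N"
  have "image_mset (count M) (mset_set Z) = image_mset (count N) (mset_set Z)"
    using image_mset_count_superset[of Z M] image_mset_count_superset[of Z N] assms
    by (auto simp: Z_def)
  then obtain p where p: "p permutes Z" "\<forall>x\<in>Z. count M x = count N (p x)"
    by (rule image_mset_eq_implies_permutes[rotated]) (auto simp: Z_def)
  have eq: "count M x = count N (p x)" for x
  proof (cases "x \<in> Z")
    case False
    then show ?thesis
      using permutes_not_in[OF p(1) False] by (auto simp: Z_def not_in_iff)
  qed (use p in auto)
  have "bij p" using p(1) by (rule permutes_bij)
  moreover have "image_mset p M = N"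
  proof (rule multiset_eqI)
    fix y
    obtain x where "y = p x" using \<open>bij p\<close> by (metis bij_pointE)
    then show "count (image_mset p M) y = count N y"
      using count_image_mset_inj[OF bij_is_inj[OF \<open>bij p\<close>]] eq by simp
  qed
  ultimately show ?thesis using that by blast
qed

lemma symmetric_series_exponents_eq:
  "symmetric_series f \<Longrightarrow> exponents M = exponents N \<Longrightarrow> f M = f N"
  by (metis exponents_eqE symmetric_series_image_mset)

lemma coeff_exponents_eq: "exponents M = exponents N \<Longrightarrow> coeff f M = coeff f N"
  using symmetric_series_exponents_eq coeff by blast

lemma finite_partitions: "finite {\<nu>. is_partition \<nu> \<and> sum_mset \<nu> \<le> d}"
proof (rule finite_subset)
  have size_le: "size \<nu> \<le> sum_mset \<nu>" if "is_partition \<nu>" for \<nu>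
    using that by (induction \<nu>) (auto simp: is_partition_def)
  show "{\<nu>. is_partition \<nu> \<and> sum_mset \<nu> \<le> d} \<subseteq> mset ` {xs. set xs \<subseteq> {..d} \<and> length xs \<le> d}"
  proof
    fix \<nu> assume \<nu>: "\<nu> \<in> {\<nu>. is_partition \<nu> \<and> sum_mset \<nu> \<le> d}"
    obtain xs where xs: "\<nu> = mset xs" using ex_mset by metis
    have "x \<le> d" if "x \<in> set xs" for x
      using \<nu> xs member_le_sum_list[OF that] by (auto simp: sum_mset_sum_list)
    then show "\<nu> \<in> mset ` {xs. set xs \<subseteq> {..d} \<and> length xs \<le> d}"
      using \<nu> xs size_le[of \<nu>] by auto
  qed
qed (simp add: finite_lists_length_le)

section \<open>Coefficient calculus and the identity E(-t) H(t) = 1\<close>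

lemmas coeff_0 [simp] = zero_symfun.rep_eq
  and coeff_1 = one_symfun.rep_eq
  and coeff_add [simp] = plus_symfun.rep_eq
  and coeff_uminus [simp] = uminus_symfun.rep_eq
  and coeff_scale [simp] = symfun_scale.rep_eq
  and coeff_monomial = monomial_sym.rep_eq
  and coeff_complete = complete_sym.rep_eq
  and coeff_elementary = elementary_sym.rep_eq

lemma coeff_diff [simp]: "coeff (f - g) M = coeff f M - coeff g M"
  by (simp add: minus_symfun_def del: add_uminus_conv_diff)

lemma coeff_sum [simp]: "coeff (sum f A) M = (\<Sum>x\<in>A. coeff (f x) M)"
  by (induction A rule: infinite_finite_induct) auto

lemma coeff_times: "coeff (f * g) M = (\<Sum>A | A \<subseteq># M. coeff f A * coeff g (M - A))"
  unfolding times_symfun.rep_eq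
  by (rule sum.reindex_bij_witness[where i = "\<lambda>A. (A, M - A)" and j = fst]) auto

lemma coeff_of_nat_mult [simp]: "coeff (of_nat n * f) M = of_nat n * coeff f M"
  by (induction n) (auto simp: distrib_right)

lemma coeff_minus_one_power_mult [simp]: "coeff ((- 1) ^ n * f) M = (- 1) ^ n * coeff f M"
  by (induction n) (auto simp: mult.assoc)

lemma symfun_scale_mult_left: "symfun_scale c f * g = symfun_scale c (f * g)"
  by (rule symfun_eqI) (simp add: coeff_times sum_distrib_left mult.assoc)

lemma symfun_scale_mult_right: "f * symfun_scale c g = symfun_scale c (f * g)"
  using symfun_scale_mult_left[of c g f] by (simp add: mult.commute)

lemma symfun_scale_of_nat: "symfun_scale (of_nat n) f = of_nat n * f"
  by (rule symfun_eqI) simp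

lemma elementary_sym_0 [simp]: "elementary_sym 0 = 1"
  by (rule symfun_eqI) (auto simp: coeff_elementary coeff_1)

lemma complete_sym_0 [simp]: "complete_sym 0 = 1"
  by (rule symfun_eqI) (auto simp: coeff_complete coeff_1)

text \<open>The complement of a submonomial contributes 1 whatever it is, so for
  \<open>size M = m\<close> the coefficient at M is the signed count of the squarefree submonomials
  of M. These are the subsets of its variables, and the signed count is (1 - 1)^r for r
  variables.\<close>

lemma sum_elementary_complete:
  "(\<Sum>i\<le>m. (- 1) ^ i * (elementary_sym i * complete_sym (m - i))) =
     (if m = 0 then 1 else 0 :: 'a :: comm_ring_1 symfun)"
proof (rule symfun_eqI)
  fix M
  have eq: "coeff ((- 1) ^ i * (elementary_sym i * complete_sym (m - i)) :: 'a symfun) M =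
      (\<Sum>A | A \<subseteq># M. (- 1) ^ i * (if size A = i \<and> (\<forall>j. count A j \<le> 1) \<and> size M = m then 1 else 0))"
    if "i \<le> m" for i
    unfolding coeff_minus_one_power_mult[of i] coeff_times[of "elementary_sym i"] sum_distrib_left
    using that by (intro sum.cong) (auto simp: coeff_elementary coeff_complete size_Diff_submset dest: size_mset_mono)
  have "coeff (\<Sum>i\<le>m. (- 1) ^ i * (elementary_sym i * complete_sym (m - i)) :: 'a symfun) M =
    (\<Sum>i\<le>m. \<Sum>A | A \<subseteq># M. (- 1) ^ i * (if size A = i \<and> (\<forall>j. count A j \<le> 1) \<and> size M = m then 1 else 0))"
    unfolding coeff_sum by (intro sum.cong refl eq) simp
  also have "\<dots> = (\<Sum>A | A \<subseteq># M. \<Sum>i\<le>m. (- 1) ^ i * (if size A = i \<and> (\<forall>j. count A j \<le> 1) \<and> size M = m then 1 else 0))"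
    by (rule sum.swap)
  also have "\<dots> = (\<Sum>A | A \<subseteq># M. \<Sum>i\<le>m. (if i = size A then
      (- 1) ^ i * (if (\<forall>j. count A j \<le> 1) \<and> size M = m then 1 else 0) else 0))"
    by (intro sum.cong) auto
  also have "\<dots> = (\<Sum>A | A \<subseteq># M. (if (\<forall>j. count A j \<le> 1) \<and> size M = m then (- 1) ^ size A else 0))"
    by (intro sum.cong) (auto dest: size_mset_mono)
  also have "\<dots> = (if size M = m then (\<Sum>A | A \<subseteq># M \<and> (\<forall>j. count A j \<le> 1). (- 1) ^ size A) else 0)"
    using sum.inter_filter[OF finite_submultisets[of M], of "\<lambda>A. (- 1 :: 'a) ^ size A"
        "\<lambda>A. \<forall>j. count A j \<le> 1"] by simp
  also have "(\<Sum>A | A \<subseteq># M \<and> (\<forall>j. count A j \<le> 1). (- 1) ^ size A :: 'a) =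
      (\<Sum>X \<in> Pow (set_mset M). (- 1) ^ card X)"
  proof (rule sum.reindex_bij_witness[where i = mset_set and j = set_mset])
    fix A assume A: "A \<in> {A. A \<subseteq># M \<and> (\<forall>j. count A j \<le> 1)}"
    show eqA: "mset_set (set_mset A) = A"
    proof (rule multiset_eqI)
      fix j
      have "count A j \<le> 1" using A by auto
      then show "count (mset_set (set_mset A)) j = count A j"
        by (cases "j \<in># A") (auto simp: count_mset_set' not_in_iff count_greater_zero_iff[symmetric]
            simp del: count_greater_zero_iff)
    qed
    show "set_mset A \<in> Pow (set_mset M)" using A set_mset_mono by blast
    show "(- 1) ^ card (set_mset A) = (- 1) ^ size A"
      by (metis eqA size_mset_set)
  next
    fix X assume X: "X \<in> Pow (set_mset M)"
    then have "finite X" by (auto intro: finite_subset)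
    with X show "set_mset (mset_set X) = X" "mset_set X \<in> {A. A \<subseteq># M \<and> (\<forall>j. count A j \<le> 1)}"
      by (auto simp: subseteq_mset_def count_mset_set' Suc_le_eq)
  qed
  also have "(\<Sum>X \<in> Pow (set_mset M). (- 1) ^ card X :: 'a) = (\<Prod>x \<in> set_mset M. 1 - 1)"
    using prod_add[of "set_mset M" "\<lambda>_. - 1 :: 'a" "\<lambda>_. 1"] by simp
  also have "(if size M = m then \<Prod>x \<in> set_mset M. 1 - 1 else 0) =
      coeff (if m = 0 then 1 else 0 :: 'a symfun) M"
    by (auto simp: coeff_1 power_0_left)
  finally show "coeff (\<Sum>i\<le>m. (- 1) ^ i * (elementary_sym i * complete_sym (m - i)) :: 'a symfun) M = \<dots>" .
qed

section \<open>The complete symmetric functions form a basis\<close>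

lemma symfun_in_span_monomials:
  fixes f :: "'a :: field symfun"
  shows "f \<in> symfun.span (monomial_sym ` {exponents M | M. coeff f M \<noteq> 0})"
proof -
  define \<Lambda> where "\<Lambda> = {exponents M | M. coeff f M \<noteq> 0}"
  \<comment> \<open>A representative monomial for each partition; the coefficient of f there is the
    coordinate of f at \<open>monomial_sym \<nu>\<close>.\<close>
  define r where "r \<nu> = (SOME M. exponents M = \<nu>)" for \<nu>
  have r: "exponents (r (exponents M)) = exponents M" for M
    unfolding r_def by (rule someI[of _ M]) simp
  have "symmetric_series (coeff f)" using coeff by blast
  then obtain d where d: "\<And>M. coeff f M \<noteq> 0 \<Longrightarrow> size M \<le> d"
    by (rule symmetric_series_bounded) blast
  have "\<Lambda> \<subseteq> {\<nu>. is_partition \<nu> \<and> sum_mset \<nu> \<le> d}"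
    using d by (auto simp: \<Lambda>_def size_eq_sum_exponents[symmetric])
  then have fin: "finite \<Lambda>" using finite_partitions finite_subset by blast
  have "f = (\<Sum>\<nu>\<in>\<Lambda>. symfun_scale (coeff f (r \<nu>)) (monomial_sym \<nu>))"
  proof (rule symfun_eqI)
    fix M
    have "(\<Sum>\<nu>\<in>\<Lambda>. coeff f (r \<nu>) * (if exponents M = \<nu> then 1 else 0)) =
        (\<Sum>\<nu>\<in>\<Lambda>. if exponents M = \<nu> then coeff f (r \<nu>) else 0)"
      by (intro sum.cong) auto
    also have "\<dots> = (if exponents M \<in> \<Lambda> then coeff f (r (exponents M)) else 0)"
      using fin by simp
    also have "\<dots> = coeff f M"
      using coeff_exponents_eq[OF r[of M], of f] by (auto simp: \<Lambda>_def)
    finally show "coeff f M = coeff (\<Sum>\<nu>\<in>\<Lambda>. symfun_scale (coeff f (r \<nu>)) (monomial_sym \<nu>)) M"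
      by (simp add: coeff_monomial)
  qed
  also have "\<dots> \<in> symfun.span (monomial_sym ` \<Lambda>)"
    by (intro symfun.span_sum symfun.span_scale symfun.span_base imageI)
  finally show ?thesis unfolding \<Lambda>_def .
qed

lemma symfun_in_span_monomialsI:
  fixes f :: "'a :: field symfun"
  assumes "\<And>M. coeff f M \<noteq> 0 \<Longrightarrow> exponents M \<in> Q"
  shows "f \<in> symfun.span (monomial_sym ` Q)"
  by (rule subsetD[OF symfun.span_mono[OF image_mono] symfun_in_span_monomials]) (use assms in blast)

text \<open>The degree bound makes the spanning set finite, which the later comparison of
  cardinalities requires, and it is additive under products.\<close>

definition complete_span :: "nat \<Rightarrow> 'a :: field symfun set" where
  "complete_span d = symfun.span (complete_part ` {\<mu>. is_partition \<mu> \<and> sum_mset \<mu> \<le> d})"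

lemma complete_span_add: "f \<in> complete_span d \<Longrightarrow> g \<in> complete_span d \<Longrightarrow> f + g \<in> complete_span d"
  unfolding complete_span_def by (rule symfun.span_add)

lemma complete_span_diff: "f \<in> complete_span d \<Longrightarrow> g \<in> complete_span d \<Longrightarrow> f - g \<in> complete_span d"
  unfolding complete_span_def by (rule symfun.span_diff)

lemma complete_span_scale: "f \<in> complete_span d \<Longrightarrow> symfun_scale c f \<in> complete_span d"
  unfolding complete_span_def by (rule symfun.span_scale)

lemma complete_span_sum: "(\<And>x. x \<in> A \<Longrightarrow> f x \<in> complete_span d) \<Longrightarrow> sum f A \<in> complete_span d"
  unfolding complete_span_def by (rule symfun.span_sum)

lemma complete_part_empty [simp]: "complete_part {#} = 1"
  by (simp add: complete_part_def)

lemma complete_part_plus: "complete_part (\<mu> + \<nu>) = complete_part \<mu> * complete_part \<nu>"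
  by (simp add: complete_part_def)

lemma complete_part_single [simp]: "complete_part {#n#} = complete_sym n"
  by (simp add: complete_part_def)

lemma complete_part_in_span:
  "is_partition \<mu> \<Longrightarrow> sum_mset \<mu> \<le> d \<Longrightarrow> complete_part \<mu> \<in> complete_span d"
  unfolding complete_span_def by (intro symfun.span_base) auto

lemma complete_sym_in_span: "complete_sym n \<in> complete_span n"
  using complete_part_in_span[of "{#n#}" n] complete_part_in_span[of "{#}" 0]
  by (cases "n = 0") (auto simp: is_partition_def)

lemma complete_span_times:
  fixes f g :: "'a :: field symfun"
  assumes "f \<in> complete_span d" and "g \<in> complete_span e"
  shows "f * g \<in> complete_span (d + e)"
proof -
  have part: "complete_part \<mu> * g \<in> complete_span (d + e)"
    if \<mu>: "is_partition \<mu>" "sum_mset \<mu> \<le> d" for \<mu>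
    using assms(2) unfolding complete_span_def[of e]
  proof (induction g rule: symfun.span_induct_alt)
    case base
    show ?case by (simp add: complete_span_def symfun.span_zero)
  next
    case (step c x y)
    then obtain \<nu> where \<nu>: "x = complete_part \<nu>" "is_partition \<nu>" "sum_mset \<nu> \<le> e" by auto
    have "complete_part (\<mu> + \<nu>) \<in> complete_span (d + e)"
      using \<mu> \<nu> by (intro complete_part_in_span) (auto simp: is_partition_def)
    with step(2) \<nu>(1) show ?case
      unfolding distrib_left symfun_scale_mult_right
      by (intro complete_span_add complete_span_scale) (simp_all add: complete_part_plus)
  qed
  show ?thesis
    using assms(1) unfolding complete_span_def[of d]
  proof (induction f rule: symfun.span_induct_alt)
    case base
    show ?case by (simp add: complete_span_def symfun.span_zero)
  next
    case (step c x y)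
    then obtain \<mu> where \<mu>: "x = complete_part \<mu>" "is_partition \<mu>" "sum_mset \<mu> \<le> d" by auto
    then have "x * g \<in> complete_span (d + e)" using part by simp
    with step(2) show ?case
      unfolding distrib_right symfun_scale_mult_left
      by (intro complete_span_add complete_span_scale)
  qed
qed

lemma complete_span_mono: "d \<le> e \<Longrightarrow> complete_span d \<subseteq> complete_span e"
  unfolding complete_span_def by (intro symfun.span_mono) auto

section \<open>Power sums and Newton's identities\<close>

lemma exponents_eq_single_iff:
  assumes "n > 0"
  shows "exponents M = {#n#} \<longleftrightarrow> (\<exists>j. M = replicate_mset n j)"
proof
  assume eq: "exponents M = {#n#}"
  then have "card (set_mset M) = 1" by (metis size_exponents size_single)
  then obtain j where j: "set_mset M = {j}" by (auto simp: card_1_singleton_iff)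
  then have "M = replicate_mset (size M) j" by (metis set_mset_subset_singletonD subset_refl)
  moreover have "size M = n" using eq by (simp add: size_eq_sum_exponents)
  ultimately show "\<exists>j. M = replicate_mset n j" by blast
qed (use assms in \<open>auto simp: exponents_replicate\<close>)

text \<open>\<open>monomial_sym {#n#}\<close> is the power sum p_n; the only submonomials of M that
  it sees are the powers x_j^n.\<close>

lemma coeff_power_sum_times:
  assumes "n > 0"
  shows "coeff (monomial_sym {#n#} * f) M =
    (\<Sum>j | j \<in># M \<and> n \<le> count M j. coeff f (M - replicate_mset n j))"
proof -
  have "coeff (monomial_sym {#n#} * f) M =
      (\<Sum>A | A \<subseteq># M. if exponents A = {#n#} then coeff f (M - A) else 0)"
    unfolding coeff_times by (intro sum.cong) (auto simp: coeff_monomial)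
  also have "\<dots> = (\<Sum>A | A \<subseteq># M \<and> exponents A = {#n#}. coeff f (M - A))"
    using sum.inter_filter[OF finite_submultisets[of M], of "\<lambda>A. coeff f (M - A)"
        "\<lambda>A. exponents A = {#n#}"] by simp
  also have "\<dots> = (\<Sum>A \<in> replicate_mset n ` {j. j \<in># M \<and> n \<le> count M j}. coeff f (M - A))"
    using assms
    by (intro sum.cong)
       (auto simp: exponents_eq_single_iff count_le_replicate_mset_subset_eq[symmetric]
          count_greater_zero_iff[symmetric] image_iff intro: less_le_trans simp del: count_greater_zero_iff)
  also have "\<dots> = (\<Sum>j | j \<in># M \<and> n \<le> count M j. coeff f (M - replicate_mset n j))"
    using assms by (subst sum.reindex) (auto simp: inj_on_def replicate_mset_eq_iff)
  finally show ?thesis .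
qed

text \<open>Double counting: for M of degree n the right side counts the pairs (j, i) with i \<ge> 1
  such that x_j^i divides M. Each x_j occurs in as many pairs as its exponent, which makes n in
  total.\<close>

lemma newton_complete:
  "of_nat n * complete_sym n = (\<Sum>i\<in>{1..n}. monomial_sym {#i#} * complete_sym (n - i) :: 'a :: comm_ring_1 symfun)"
proof (rule symfun_eqI)
  fix M
  have "coeff (monomial_sym {#i#} * complete_sym (n - i) :: 'a symfun) M =
      (\<Sum>j\<in>set_mset M. if i \<le> count M j \<and> size M = n then 1 else 0)" if i: "i \<in> {1..n}" for i
  proof -
    have "coeff (monomial_sym {#i#} * complete_sym (n - i) :: 'a symfun) M =
        (\<Sum>j | j \<in># M \<and> i \<le> count M j. if size M = n then 1 else 0)"
    proof (subst coeff_power_sum_times)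
      show "(\<Sum>j | j \<in># M \<and> i \<le> count M j. coeff (complete_sym (n - i) :: 'a symfun) (M - replicate_mset i j)) =
        (\<Sum>j | j \<in># M \<and> i \<le> count M j. if size M = n then 1 else 0)"
      proof (intro sum.cong refl)
        fix j assume j: "j \<in> {j. j \<in># M \<and> i \<le> count M j}"
        then have "replicate_mset i j \<subseteq># M" by (simp add: count_le_replicate_mset_subset_eq)
        then have "size (M - replicate_mset i j) = size M - i" "i \<le> size M"
          by (auto simp: size_Diff_submset dest: size_mset_mono)
        then show "coeff (complete_sym (n - i) :: 'a symfun) (M - replicate_mset i j) = (if size M = n then 1 else 0)"
          using i by (auto simp: coeff_complete)
      qed
    qed (use i in auto)
    also have "\<dots> = (\<Sum>j\<in>set_mset M. if i \<le> count M j \<and> size M = n then 1 else 0)"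
      using sum.inter_filter[of "set_mset M" "\<lambda>j. if size M = n then 1 else (0 :: 'a)" "\<lambda>j. i \<le> count M j"]
      by (auto intro!: sum.cong)
    finally show ?thesis .
  qed
  then have "coeff (\<Sum>i\<in>{1..n}. monomial_sym {#i#} * complete_sym (n - i) :: 'a symfun) M =
      (\<Sum>i\<in>{1..n}. \<Sum>j\<in>set_mset M. if i \<le> count M j \<and> size M = n then 1 else 0)"
    by (simp only: coeff_sum cong: sum.cong)
  also have "\<dots> = (\<Sum>j\<in>set_mset M. \<Sum>i\<in>{1..n}. if i \<le> count M j \<and> size M = n then 1 else 0)"
    by (rule sum.swap)
  also have "\<dots> = (\<Sum>j\<in>set_mset M. if size M = n then of_nat (count M j) else 0)"
  proof (intro sum.cong refl)
    fix j assume "j \<in># M"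
    have "{i \<in> {1..n}. i \<le> count M j} = {1..count M j}" if "size M = n"
      using that count_le_size[of M j] by auto
    then show "(\<Sum>i\<in>{1..n}. if i \<le> count M j \<and> size M = n then 1 else (0 :: 'a)) =
        (if size M = n then of_nat (count M j) else 0)"
      using sum.inter_filter[of "{1..n}" "\<lambda>i. 1 :: 'a" "\<lambda>i. i \<le> count M j"] by auto
  qed
  also have "\<dots> = coeff (of_nat n * complete_sym n :: 'a symfun) M"
    by (auto simp: coeff_complete size_multiset_overloaded_eq)
  finally show "coeff (of_nat n * complete_sym n :: 'a symfun) M =
      coeff (\<Sum>i\<in>{1..n}. monomial_sym {#i#} * complete_sym (n - i)) M"
    by (rule sym)
qed

lemma power_sum_in_complete_span:
  "n > 0 \<Longrightarrow> monomial_sym {#n#} \<in> (complete_span n :: 'a :: field_char_0 symfun set)"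
proof (induction n rule: less_induct)
  case (less n)
  have split: "{1..n} = insert n {1..<n}" using less.prems by auto
  have "of_nat n * complete_sym n =
      monomial_sym {#n#} + (\<Sum>i\<in>{1..<n}. monomial_sym {#i#} * complete_sym (n - i) :: 'a symfun)"
    unfolding newton_complete split by simp
  then have eq: "monomial_sym {#n#} = symfun_scale (of_nat n) (complete_sym n) -
      (\<Sum>i\<in>{1..<n}. monomial_sym {#i#} * complete_sym (n - i) :: 'a symfun)"
    by (simp add: symfun_scale_of_nat)
  have "monomial_sym {#i#} * complete_sym (n - i) \<in> (complete_span n :: 'a symfun set)"
    if "i \<in> {1..<n}" for i
    using complete_span_times[OF less.IH complete_sym_in_span, of i "n - i"] that by auto
  then show ?case
    unfolding eq by (intro complete_span_diff complete_span_scale complete_span_sum complete_sym_in_span)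
qed

text \<open>
  Multiplying \<open>m\<^sub>\<nu>\<close> by the power sum \<open>p\<^sub>n\<close> yields a nonzero multiple of \<open>m\<^sub>\<nu>\<^sub>\<union>\<^sub>n\<close> plus monomial
  functions of partitions with \<open>l(\<nu>)\<close> parts, which drives an induction on the number of parts.
\<close>

lemma monomial_in_complete_span:
  "is_partition \<nu> \<Longrightarrow> monomial_sym \<nu> \<in> (complete_span (sum_mset \<nu>) :: 'a :: field_char_0 symfun set)"
proof (induction "size \<nu>" arbitrary: \<nu>)
  case 0
  have "monomial_sym {#} = (1 :: 'a symfun)"
    by (rule symfun_eqI) (auto simp: coeff_monomial coeff_1)
  then show ?case
    using 0 complete_part_in_span[of "{#}" 0, where 'a = 'a] by (auto simp: is_partition_def)
next
  case (Suc l)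
  then obtain n \<mu> where \<nu>: "\<nu> = add_mset n \<mu>" by (metis size_eq_Suc_imp_eq_union)
  then have n: "n > 0" and \<mu>: "is_partition \<mu>" "size \<mu> = l"
    using Suc.prems Suc.hyps(2) by (auto simp: is_partition_def)
  define g :: "'a symfun" where "g = monomial_sym {#n#} * monomial_sym \<mu>"
  have g_span: "g \<in> complete_span (sum_mset \<nu>)"
    using complete_span_times[OF power_sum_in_complete_span[OF n] Suc.hyps(1)[OF \<mu>(2)[symmetric] \<mu>(1)]]
    by (simp add: \<nu> g_def)
  obtain M\<^sub>1 where M1: "exponents M\<^sub>1 = \<mu>" using exponents_surj[OF \<mu>(1)] .
  obtain j where j: "j \<notin># M\<^sub>1" using ex_new_if_finite[OF infinite_UNIV_nat] by blast
  define M\<^sub>0 where "M\<^sub>0 = M\<^sub>1 + replicate_mset n j"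
  have M0: "exponents M\<^sub>0 = \<nu>" using j n M1 by (simp add: M\<^sub>0_def \<nu> exponents_plus_replicate)
  \<comment> \<open>The variables x_i whose power x_i^n can be removed to leave type \<mu>. The
    fresh \<open>j\<close> is one of them, so the coefficient is a positive integer, nonzero in
    characteristic 0.\<close>
  define J where "J = {i. i \<in># M\<^sub>0 \<and> n \<le> count M\<^sub>0 i \<and> exponents (M\<^sub>0 - replicate_mset n i) = \<mu>}"
  have "coeff g M\<^sub>0 = (\<Sum>i | i \<in># M\<^sub>0 \<and> n \<le> count M\<^sub>0 i.
      if exponents (M\<^sub>0 - replicate_mset n i) = \<mu> then 1 else 0)"
    unfolding g_def coeff_power_sum_times[OF n] by (simp add: coeff_monomial)
  also have "\<dots> = of_nat (card J)"
    using sum.inter_filter[of "{i. i \<in># M\<^sub>0 \<and> n \<le> count M\<^sub>0 i}" "\<lambda>_. 1 :: 'a"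
        "\<lambda>i. exponents (M\<^sub>0 - replicate_mset n i) = \<mu>"]
    by (simp add: J_def conj_assoc)
  finally have "coeff g M\<^sub>0 = of_nat (card J)" .
  moreover have "j \<in> J" using n M1 by (simp add: J_def M\<^sub>0_def)
  moreover have "finite J" by (simp add: J_def)
  ultimately have c: "coeff g M\<^sub>0 \<noteq> 0" by auto
  define r where "r = g - symfun_scale (coeff g M\<^sub>0) (monomial_sym \<nu>)"
  have "exponents N \<in> {\<kappa>. is_partition \<kappa> \<and> size \<kappa> = l \<and> sum_mset \<kappa> = sum_mset \<nu>}"
    if "coeff r N \<noteq> 0" for N
  proof -
    have ne: "exponents N \<noteq> \<nu>"
    proof
      assume eq: "exponents N = \<nu>"
      then have "coeff g N = coeff g M\<^sub>0" using M0 by (metis coeff_exponents_eq)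
      then show False using that eq by (simp add: r_def coeff_monomial)
    qed
    then have "coeff g N \<noteq> 0" using that by (simp add: r_def coeff_monomial)
    then obtain i where i: "i \<in># N" "n \<le> count N i" "exponents (N - replicate_mset n i) = \<mu>"
      unfolding g_def coeff_power_sum_times[OF n]
      by (auto simp: coeff_monomial elim!: sum.not_neutral_contains_not_neutral split: if_splits)
    obtain N' where N: "N = N' + replicate_mset n i" and N': "exponents N' = \<mu>"
      using i(2,3) by (metis count_le_replicate_mset_subset_eq subset_mset.diff_add)
    \<comment> \<open>If x_i were new, N would have type \<nu>. So the factor x_i^n adds no
      variable, and N has only l of them.\<close>
    have "i \<in># N'"
    proof (rule ccontr)
      assume "i \<notin># N'"
      then have "exponents N = \<nu>" using N' n by (simp add: N exponents_plus_replicate \<nu>)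
      with ne show False by blast
    qed
    then have "set_mset N = set_mset N'" by (auto simp: N)
    then have "size (exponents N) = size (exponents N')" by (simp add: size_exponents)
    then have "size (exponents N) = l" using N' \<mu>(2) by simp
    moreover have "sum_mset (exponents N) = sum_mset \<nu>"
      unfolding size_eq_sum_exponents[symmetric] by (simp add: N \<nu> size_eq_sum_exponents[of N'] N')
    ultimately show ?thesis by simp
  qed
  then have "r \<in> symfun.span (monomial_sym ` {\<kappa>. is_partition \<kappa> \<and> size \<kappa> = l \<and> sum_mset \<kappa> = sum_mset \<nu>})"
    by (rule symfun_in_span_monomialsI)
  also have "\<dots> \<subseteq> complete_span (sum_mset \<nu>)"
  proof -
    have "monomial_sym \<kappa> \<in> (complete_span (sum_mset \<nu>) :: 'a symfun set)"
      if "is_partition \<kappa>" "size \<kappa> = l" "sum_mset \<kappa> = sum_mset \<nu>" for \<kappa>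
      using Suc.hyps(1)[of \<kappa>] that by metis
    then show ?thesis
      unfolding complete_span_def by (intro symfun.span_minimal symfun.subspace_span) blast
  qed
  finally have "symfun_scale (inverse (coeff g M\<^sub>0)) (g - r) \<in> complete_span (sum_mset \<nu>)"
    by (intro complete_span_scale complete_span_diff g_span)
  moreover have "symfun_scale (inverse (coeff g M\<^sub>0)) (g - r) = monomial_sym \<nu>"
    using c by (simp add: r_def)
  ultimately show ?case by simp
qed

section \<open>Spanning and linear independence\<close>

lemma span_monomial_sym:
  "symfun.span (monomial_sym ` {\<mu>. is_partition \<mu>}) = (UNIV :: 'a :: field symfun set)"
  using symfun_in_span_monomialsI[of _ "{\<mu>. is_partition \<mu>}"] by auto

lemma span_complete_part:
  "symfun.span (complete_part ` {\<mu>. is_partition \<mu>}) = (UNIV :: 'a :: field_char_0 symfun set)"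
proof -
  have "complete_span d \<subseteq> (symfun.span (complete_part ` {\<mu>. is_partition \<mu>}) :: 'a symfun set)" for d
    unfolding complete_span_def by (intro symfun.span_mono) auto
  then have "monomial_sym ` {\<mu>. is_partition \<mu>} \<subseteq>
      (symfun.span (complete_part ` {\<mu>. is_partition \<mu>}) :: 'a symfun set)"
    using monomial_in_complete_span by blast
  then have "symfun.span (monomial_sym ` {\<mu>. is_partition \<mu>}) \<subseteq>
      (symfun.span (complete_part ` {\<mu>. is_partition \<mu>}) :: 'a symfun set)"
    by (intro symfun.span_minimal symfun.subspace_span)
  then show ?thesis by (simp add: span_monomial_sym top.extremum_unique)
qed

lemma inj_on_monomial_sym: "inj_on (monomial_sym :: _ \<Rightarrow> 'a :: comm_ring_1 symfun) {\<mu>. is_partition \<mu>}"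
proof (rule inj_onI)
  fix \<mu> \<nu> assume "\<mu> \<in> {\<mu>. is_partition \<mu>}" and eq: "monomial_sym \<mu> = (monomial_sym \<nu> :: 'a symfun)"
  then obtain M where "exponents M = \<mu>" using exponents_surj by blast
  then show "\<mu> = \<nu>" using arg_cong[OF eq, of "\<lambda>f. coeff f M"] by (auto simp: coeff_monomial split: if_splits)
qed

lemma independent_monomial_sym:
  "symfun.independent (monomial_sym ` {\<mu>. is_partition \<mu>} :: 'a :: field symfun set)"
  unfolding symfun.independent_explicit_finite_subsets
proof (intro allI impI ballI)
  fix S u v
  assume S: "S \<subseteq> monomial_sym ` {\<mu>. is_partition \<mu>}" "finite S"
    and 0: "(\<Sum>v\<in>S. symfun_scale (u v) v) = (0 :: 'a symfun)" and v: "v \<in> S"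
  obtain \<mu> where \<mu>: "is_partition \<mu>" "v = monomial_sym \<mu>" using S v by blast
  obtain M where M: "exponents M = \<mu>" using exponents_surj[OF \<mu>(1)] .
  have "u w * coeff w M = (if w = v then u w else 0)" if "w \<in> S" for w
  proof -
    obtain \<kappa> where \<kappa>: "is_partition \<kappa>" "w = monomial_sym \<kappa>"
      using \<open>w \<in> S\<close> S(1) by blast
    then have "w = v \<longleftrightarrow> \<kappa> = \<mu>"
      using \<mu> inj_on_eq_iff[OF inj_on_monomial_sym, of \<kappa> \<mu>] by simp
    then show ?thesis using M \<kappa>(2) by (simp add: coeff_monomial)
  qed
  then have "(\<Sum>w\<in>S. u w * coeff w M) = (\<Sum>w\<in>S. if w = v then u w else 0)" by simp
  also have "\<dots> = u v" using S(2) v by simp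
  finally show "u v = 0" using arg_cong[OF 0, of "\<lambda>f. coeff f M"] by simp
qed

text \<open>
  Independence is a dimension count: up to degree \<open>d\<close> the \<open>h\<^sub>\<mu>\<close> span the linearly independent
  \<open>m\<^sub>\<mu>\<close>, and there are equally many of both.
\<close>

lemma complete_part_bounded:
  defines "P d \<equiv> {\<mu>. is_partition \<mu> \<and> sum_mset \<mu> \<le> d}"
  shows "inj_on (complete_part :: _ \<Rightarrow> 'a :: field_char_0 symfun) (P d)"
    and "symfun.independent (complete_part ` P d :: 'a symfun set)"
proof -
  let ?h = "complete_part :: _ \<Rightarrow> 'a symfun" and ?m = "monomial_sym :: _ \<Rightarrow> 'a symfun"
  have fin: "finite (P d)" unfolding P_def by (rule finite_partitions)
  have sub: "?m ` P d \<subseteq> complete_span d"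
    using monomial_in_complete_span complete_span_mono by (auto simp: P_def)
  have "symfun.independent (?m ` P d)"
    by (rule symfun.independent_mono[OF independent_monomial_sym]) (auto simp: P_def)
  moreover have "card (?m ` P d) = card (P d)"
    by (intro card_image inj_on_subset[OF inj_on_monomial_sym]) (auto simp: P_def)
  \<comment> \<open>The independent m_\<mu> lie in the span of every such T, so T is at least as
    large. Applied to all the h_\<mu>, this forces injectivity; applied to them without a redundant
    element, it yields a contradiction.\<close>
  ultimately have bound: "card (P d) \<le> card T" if "finite T" "complete_span d \<subseteq> symfun.span T" for T :: "'a symfun set"
    using symfun.independent_span_bound[OF that(1), of "?m ` P d"] that(2) sub by auto
  have "card (P d) \<le> card (?h ` P d)"
    using fin by (intro bound) (auto simp: complete_span_def P_def)
  then have card_eq: "card (?h ` P d) = card (P d)" using card_image_le[OF fin, of ?h] by simp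
  then show "inj_on ?h (P d)" using fin by (simp add: eq_card_imp_inj_on)
  show "symfun.independent (?h ` P d)"
  proof
    assume "symfun.dependent (?h ` P d)"
    then obtain x where x: "x \<in> ?h ` P d" "x \<in> symfun.span (?h ` P d - {x})"
      unfolding symfun.dependent_def by blast
    then have "symfun.span (?h ` P d) = symfun.span (?h ` P d - {x})"
      using symfun.span_redundant[OF x(2)] by (simp add: insert_absorb)
    then have "card (P d) \<le> card (?h ` P d - {x})"
      using fin by (intro bound) (auto simp: complete_span_def P_def)
    moreover have "card (?h ` P d - {x}) < card (?h ` P d)"
      using x(1) fin by (intro card_Diff1_less) auto
    ultimately show False using card_eq by simp
  qed
qed

lemma inj_on_complete_part:
  "inj_on (complete_part :: _ \<Rightarrow> 'a :: field_char_0 symfun) {\<mu>. is_partition \<mu>}"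
proof (rule inj_onI)
  fix \<mu> \<nu>
  assume "\<mu> \<in> {\<mu>. is_partition \<mu>}" "\<nu> \<in> {\<mu>. is_partition \<mu>}"
    and "complete_part \<mu> = (complete_part \<nu> :: 'a symfun)"
  then show "\<mu> = \<nu>"
    by (intro inj_onD[OF complete_part_bounded(1)[of "max (sum_mset \<mu>) (sum_mset \<nu>)"]]) auto
qed

lemma independent_complete_part:
  "symfun.independent (complete_part ` {\<mu>. is_partition \<mu>} :: 'a :: field_char_0 symfun set)"
  unfolding symfun.independent_explicit_finite_subsets
proof (intro allI impI)
  fix S and u :: "'a symfun \<Rightarrow> 'a"
  assume sub: "S \<subseteq> complete_part ` {\<mu>. is_partition \<mu>}" and fin: "finite S"
    and 0: "(\<Sum>v\<in>S. symfun_scale (u v) v) = (0 :: 'a symfun)"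
  obtain Q where Q: "Q \<subseteq> {\<mu>. is_partition \<mu>}" "finite Q" "S = complete_part ` Q"
    using finite_subset_image[OF fin sub] by blast
  \<comment> \<open>A dependence involves finitely many partitions, so one degree bound covers it;
    the 0 keeps \<open>Max\<close> meaningful for empty \<open>Q\<close>.\<close>
  define d where "d = Max (insert 0 (sum_mset ` Q))"
  have "S \<subseteq> complete_part ` {\<mu>. is_partition \<mu> \<and> sum_mset \<mu> \<le> d}"
    using Q by (auto simp: d_def)
  then show "\<forall>v\<in>S. u v = 0"
    using complete_part_bounded(2)[of d, where 'a = 'a] fin 0
    unfolding symfun.independent_explicit_finite_subsets by blast
qed

section \<open>The Hall inner product and adjoint operators\<close>

lemma vector_space_field: "vector_space ((*) :: 'a :: field \<Rightarrow> 'a \<Rightarrow> 'a)"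
  by unfold_locales (auto simp: algebra_simps)

lemma vector_space_pair_symfun: "vector_space_pair symfun_scale ((*) :: 'a :: field \<Rightarrow> 'a \<Rightarrow> 'a)"
  by (simp add: vector_space_pair_def vector_space_field symfun.vector_space_axioms)

lemma linear_functional_iff:
  "Vector_Spaces.linear symfun_scale (*) (L :: 'a :: field symfun \<Rightarrow> 'a) \<longleftrightarrow>
     (\<forall>f g. L (f + g) = L f + L g) \<and> (\<forall>c f. L (symfun_scale c f) = c * L f)"
  by (simp add: Vector_Spaces.linear_iff vector_space_field symfun.vector_space_axioms)

lemma linear_functional_eqI:
  fixes L K :: "'a :: field symfun \<Rightarrow> 'a"
  assumes "Vector_Spaces.linear symfun_scale (*) L" and "Vector_Spaces.linear symfun_scale (*) K"
    and "symfun.span B = UNIV" and "\<And>b. b \<in> B \<Longrightarrow> L b = K b"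
  shows "L f = K f"
  using vector_space_pair.linear_eq_on[OF vector_space_pair_symfun assms(1,2), of f B] assms(3,4)
  by simp

lemma is_hall_form_unique:
  fixes B C :: "'a :: field_char_0 symfun \<Rightarrow> 'a symfun \<Rightarrow> 'a"
  assumes "is_hall_form B" and "is_hall_form C"
  shows "B = C"
proof (intro ext)
  fix f g
  have "B (monomial_sym \<nu>) g = C (monomial_sym \<nu>) g" if "is_partition \<nu>" for \<nu>
    by (rule linear_functional_eqI[OF _ _ span_complete_part])
       (use assms that in \<open>auto simp: is_hall_form_def\<close>)
  moreover have "Vector_Spaces.linear symfun_scale (*) (\<lambda>f. B f g)"
    "Vector_Spaces.linear symfun_scale (*) (\<lambda>f. C f g)"
    using assms unfolding is_hall_form_def by blast+
  ultimately show "B f g = C f g"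
    using linear_functional_eqI[OF _ _ span_monomial_sym, of "\<lambda>f. B f g" "\<lambda>f. C f g" f] by blast
qed

text \<open>Duality forces the pairing of f with h_\<mu> to be the coefficient of f at a monomial of
  type \<mu>. As the h_\<mu> are a basis, this prescription extends linearly in the second
  argument.\<close>

lemma is_hall_form_exists: "\<exists>B :: 'a :: field_char_0 symfun \<Rightarrow> 'a symfun \<Rightarrow> 'a. is_hall_form B"
proof -
  interpret vector_space_pair symfun_scale "(*) :: 'a \<Rightarrow> 'a \<Rightarrow> 'a"
    by (rule vector_space_pair_symfun)
  define H :: "'a symfun set" where "H = complete_part ` {\<mu>. is_partition \<mu>}"
  have ind: "symfun.independent H" unfolding H_def by (rule independent_complete_part)
  \<comment> \<open>Recovers a monomial of type \<mu> from the element h_\<mu> itself, which works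
    because distinct partitions give distinct h_\<mu>.\<close>
  define r where "r h = (SOME M. complete_part (exponents M) = (h :: 'a symfun))" for h
  have r: "exponents (r (complete_part \<mu>)) = \<mu>" if "is_partition \<mu>" for \<mu>
  proof -
    obtain M where "exponents M = \<mu>" using exponents_surj[OF \<open>is_partition \<mu>\<close>] .
    then have "complete_part (exponents M) = (complete_part \<mu> :: 'a symfun)" by simp
    then have "complete_part (exponents (r (complete_part \<mu>))) = (complete_part \<mu> :: 'a symfun)"
      unfolding r_def by (rule someI)
    then show ?thesis using inj_onD[OF inj_on_complete_part[where 'a = 'a]] \<open>is_partition \<mu>\<close> by auto
  qed
  define B where "B f = construct H (\<lambda>h. coeff f (r h))" for f
  have "is_hall_form B"
    unfolding is_hall_form_def
  proof (intro conjI allI impI)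
    show "Vector_Spaces.linear symfun_scale (*) (B f)" for f
      unfolding B_def by (rule linear_construct[OF ind])
    show "Vector_Spaces.linear symfun_scale (*) (\<lambda>f. B f g)" for g
      unfolding linear_functional_iff B_def by (simp add: construct_add[OF ind] construct_scale[OF ind])
    show "B (monomial_sym \<nu>) (complete_part \<mu>) = (if \<nu> = \<mu> then 1 else 0)"
      if "is_partition \<nu>" "is_partition \<mu>" for \<nu> \<mu>
    proof -
      have "complete_part \<mu> \<in> H" using that by (simp add: H_def)
      then show ?thesis using that by (simp add: B_def construct_basis[OF ind] r coeff_monomial)
    qed
  qed
  then show ?thesis by blast
qed

lemma is_hall_form_hall: "is_hall_form (hall :: 'a :: field_char_0 symfun \<Rightarrow> 'a symfun \<Rightarrow> 'a)"
  unfolding hall_def using is_hall_form_exists is_hall_form_unique by (metis theI)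

lemma linear_hall_left: "Vector_Spaces.linear symfun_scale (*) (\<lambda>f. hall f g)"
  and linear_hall_right: "Vector_Spaces.linear symfun_scale (*) (\<lambda>g. hall f g)"
  using is_hall_form_hall unfolding is_hall_form_def by blast+

lemma hall_add_left [simp]: "hall (f + g) v = hall f v + hall g v"
  and hall_scale_left [simp]: "hall (symfun_scale c f) v = c * hall f v"
  using linear_hall_left[of v] by (auto simp: linear_functional_iff)

lemma hall_add_right [simp]: "hall f (u + v) = hall f u + hall f v"
  and hall_scale_right [simp]: "hall f (symfun_scale c v) = c * hall f v"
  using linear_hall_right[of f] by (auto simp: linear_functional_iff)

lemma hall_zero_left [simp]: "hall 0 v = 0"
  using hall_scale_left[of 0 0 v] by simp

lemma hall_zero_right [simp]: "hall f 0 = 0"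
  using hall_scale_right[of f 0 0] by simp

lemma hall_monomial_complete:
  assumes "is_partition \<nu>" and "is_partition \<mu>"
  shows "hall (monomial_sym \<nu>) (complete_part \<mu>) = (if \<nu> = \<mu> then 1 else 0)"
  using is_hall_form_hall assms unfolding is_hall_form_def by blast

lemma hall_complete_part: "hall f (complete_part (exponents M)) = coeff f M"
proof (rule linear_functional_eqI[OF linear_hall_left _ span_monomial_sym])
  show "Vector_Spaces.linear symfun_scale (*) (\<lambda>f. coeff f M)"
    by (simp add: linear_functional_iff)
  show "hall b (complete_part (exponents M)) = coeff b M" if "b \<in> monomial_sym ` {\<mu>. is_partition \<mu>}" for b
    using that by (auto simp: coeff_monomial hall_monomial_complete)
qed

lemma hall_nondegenerate: "(\<And>v. hall f v = hall g v) \<Longrightarrow> f = g"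
  by (rule symfun_eqI) (metis hall_complete_part)

lemma hall_eqI:
  assumes "Vector_Spaces.linear symfun_scale (*) L"
    and "\<And>M. hall f (complete_part (exponents M)) = L (complete_part (exponents M))"
  shows "hall f v = L v"
  by (rule linear_functional_eqI[OF linear_hall_right assms(1) span_complete_part])
     (use assms(2) in \<open>auto elim!: exponents_surj\<close>)

text \<open>The adjoint of multiplication by \<open>h\<^sub>n\<close> extracts the coefficient of \<open>x\<^sub>j\<^sup>n\<close> for a fresh variable \<open>x\<^sub>j\<close>.\<close>

lift_definition complete_perp :: "nat \<Rightarrow> 'a :: comm_ring_1 symfun \<Rightarrow> 'a symfun" is
  "\<lambda>n f M. f (M + replicate_mset n (SOME j. j \<notin># M))"
proof -
  fix n and f :: "nat multiset \<Rightarrow> 'a"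
  assume f: "symmetric_series f"
  have fresh: "(SOME j. j \<notin># M) \<notin># M" for M :: "nat multiset"
    using ex_new_if_finite[OF infinite_UNIV_nat, of "set_mset M"] by (rule someI_ex) simp
  obtain d where d: "\<And>M. f M \<noteq> 0 \<Longrightarrow> size M \<le> d" using symmetric_series_bounded[OF f] by blast
  show "symmetric_series (\<lambda>M. f (M + replicate_mset n (SOME j. j \<notin># M)))"
  proof (rule symmetric_seriesI[of _ d])
    fix M assume "f (M + replicate_mset n (SOME j. j \<notin># M)) \<noteq> 0"
    then show "size M \<le> d" using d by fastforce
  next
    fix \<pi> :: "nat \<Rightarrow> nat" and M assume \<pi>: "bij \<pi>"
    show "f (image_mset \<pi> M + replicate_mset n (SOME j. j \<notin># image_mset \<pi> M)) =
        f (M + replicate_mset n (SOME j. j \<notin># M))"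
    proof (cases "n = 0")
      case True
      then show ?thesis using symmetric_series_image_mset[OF f \<pi>] by simp
    next
      case False
      then show ?thesis
        using fresh[of M] fresh[of "image_mset \<pi> M"]
        by (intro symmetric_series_exponents_eq[OF f])
           (simp add: exponents_plus_replicate exponents_image_mset[OF \<pi>])
    qed
  qed
qed

text \<open>All fresh variables give monomials of the same type, so the arbitrary choice in the
  definition can be traded for whichever fresh variable is at hand.\<close>

lemma coeff_complete_perp:
  assumes "j \<notin># M"
  shows "coeff (complete_perp n f) M = coeff f (M + replicate_mset n j)"
proof (cases "n = 0")
  case False
  have "(SOME j. j \<notin># M) \<notin># M" using assms by (rule someI)
  with False assms show ?thesis
    unfolding complete_perp.rep_eq by (intro coeff_exponents_eq) (simp add: exponents_plus_replicate)
qed (simp add: complete_perp.rep_eq)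

text \<open>Against h_\<mu> with \<mu> the type of M, the factor h_n adds a part n to \<mu>.
  Multiplying M by x_j^n for a fresh x_j does the same.\<close>

lemma hall_complete_perp:
  fixes f v :: "'a :: field_char_0 symfun"
  shows "hall (complete_perp n f) v = hall f (complete_sym n * v)"
proof (rule hall_eqI)
  show "Vector_Spaces.linear symfun_scale (*) (\<lambda>v. hall f (complete_sym n * v))"
    by (simp add: linear_functional_iff distrib_left symfun_scale_mult_right)
  fix M :: "nat multiset"
  obtain j where j: "j \<notin># M" using ex_new_if_finite[OF infinite_UNIV_nat] by blast
  show "hall (complete_perp n f) (complete_part (exponents M)) =
      hall f (complete_sym n * complete_part (exponents M))"
  proof (cases "n = 0")
    case False
    have "complete_sym n * complete_part (exponents M) =
        (complete_part (exponents (M + replicate_mset n j)) :: 'a symfun)"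
      using False j by (simp add: exponents_plus_replicate complete_part_def)
    then show ?thesis using j by (simp add: hall_complete_part coeff_complete_perp)
  qed (simp add: hall_complete_part coeff_complete_perp[OF j])
qed

text \<open>In infinite dimension an adjoint need not exist. Here the explicit adjoints of the h_n
  compose to one for each h_\<mu>, and linear combinations of these serve every g because the
  h_\<mu> span.\<close>

lemma adjoint_exists:
  fixes f g :: "'a :: field_char_0 symfun"
  shows "\<exists>u. \<forall>v. hall u v = hall f (g * v)"
proof -
  have part: "\<exists>u. \<forall>v. hall u v = hall f (complete_part \<mu> * v)" for \<mu> and f :: "'a symfun"
  proof (induction \<mu> arbitrary: f)
    case (add n \<mu>)
    then obtain u where "\<forall>v. hall u v = hall (complete_perp n f) (complete_part \<mu> * v)" by blast
    then have "\<forall>v. hall u v = hall f (complete_part (add_mset n \<mu>) * v)"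
      by (simp add: hall_complete_perp complete_part_def mult.assoc)
    then show ?case by blast
  qed auto
  have "g \<in> symfun.span (complete_part ` {\<mu>. is_partition \<mu>})" by (simp add: span_complete_part)
  then show ?thesis
  proof (induction g rule: symfun.span_induct_alt)
    case base
    have "\<forall>v. hall 0 v = hall f (0 * v)" by simp
    then show ?case by blast
  next
    case (step c x y)
    obtain u w where "\<forall>v. hall u v = hall f (x * v)" "\<forall>v. hall w v = hall f (y * v)"
      using part step by blast
    then have "\<forall>v. hall (symfun_scale c u + w) v = hall f ((symfun_scale c x + y) * v)"
      by (simp add: distrib_right symfun_scale_mult_left)
    then show ?case by blast
  qed
qed

section \<open>Calculus of adjoints and the degree of e_\<mu>^perp\<close>

lemma perpI: "(\<And>v. hall u v = hall f (g * v)) \<Longrightarrow> perp g f = u"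
  unfolding perp_def by (rule the_equality) (auto intro: hall_nondegenerate)

lemma hall_perp: "hall (perp g f) v = hall f (g * v)"
proof -
  obtain u where "\<forall>v. hall u v = hall f (g * v)" using adjoint_exists by blast
  then show ?thesis using perpI[of u f g] by simp
qed

lemma perp_complete_sym: "perp (complete_sym n) f = complete_perp n f"
  by (rule perpI) (rule hall_complete_perp)

lemma perp_1 [simp]: "perp 1 f = f"
  by (rule perpI) simp

lemma perp_zero_left [simp]: "perp 0 f = 0"
  by (rule perpI) simp

lemma perp_mult: "perp (g * h) f = perp h (perp g f)"
  by (rule perpI) (simp add: hall_perp mult.assoc)

lemma perp_add_left: "perp (g + h) f = perp g f + perp h f"
  by (rule perpI) (simp add: hall_perp distrib_right)

lemma perp_sum_left: "perp (\<Sum>x\<in>A. g x) f = (\<Sum>x\<in>A. perp (g x) f)"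
  by (induction A rule: infinite_finite_induct) (simp_all add: perp_add_left)

lemma perp_scale_left: "perp (symfun_scale c g) f = symfun_scale c (perp g f)"
  by (rule perpI) (simp add: hall_perp symfun_scale_mult_left)

lemma perp_minus_one_power_left:
  fixes f g :: "'a :: field_char_0 symfun"
  shows "perp ((- 1) ^ n * g) f = (- 1) ^ n * perp g f"
proof -
  have "(- 1) ^ n * h = symfun_scale ((- 1) ^ n) h" for h :: "'a symfun"
    by (rule symfun_eqI) simp
  then show ?thesis by (simp add: perp_scale_left)
qed

text \<open>\<open>perp\<close> turns products into compositions, so E(-t) H(t) = 1 becomes an
  identity of operators. In this order h_(m-i)^perp acts last, and taking a coefficient brings in a
  fresh variable, as the elimination of variables needs.\<close>

lemma sum_complete_perp_elementary:
  "(\<Sum>i\<le>m. (- 1) ^ i * complete_perp (m - i) (perp (elementary_sym i) f)) = (if m = 0 then f else 0)"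
proof -
  have "(\<Sum>i\<le>m. (- 1) ^ i * complete_perp (m - i) (perp (elementary_sym i) f)) =
      perp (\<Sum>i\<le>m. (- 1) ^ i * (elementary_sym i * complete_sym (m - i))) f"
    unfolding perp_sum_left perp_minus_one_power_left by (simp add: perp_mult perp_complete_sym)
  then show ?thesis by (simp add: sum_elementary_complete)
qed

text \<open>In this order h_(m-i)^perp acts on f first, where its effect on the degree is visible;
  the degree bound recurses along it.\<close>

lemma sum_elementary_complete_perp:
  "(\<Sum>i\<le>m. (- 1) ^ i * perp (elementary_sym i) (complete_perp (m - i) f)) = (if m = 0 then f else 0)"
proof -
  have "(\<Sum>i\<le>m. (- 1) ^ i * perp (elementary_sym i) (complete_perp (m - i) f)) =
      perp (\<Sum>i\<le>m. (- 1) ^ i * (complete_sym (m - i) * elementary_sym i)) f"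
    unfolding perp_sum_left perp_minus_one_power_left by (simp add: perp_mult perp_complete_sym)
  then show ?thesis by (simp add: sum_elementary_complete mult.commute[of "complete_sym _"])
qed

text \<open>For n > 0 the alternating sum expresses e_n^perp f by the e_i^perp h_(n-i)^perp f with i
  < n. The inner operator lowers the degree by n - i, and induction gives i more. The slack
  \<open>s\<close> carries the drop reached so far and avoids subtraction.\<close>

lemma perp_elementary_sym_degree:
  assumes "\<And>M. coeff f M \<noteq> 0 \<Longrightarrow> size M + s \<le> d" and "coeff (perp (elementary_sym n) f) M \<noteq> 0"
  shows "size M + (s + n) \<le> d"
  using assms
proof (induction n arbitrary: f s M rule: less_induct)
  case (less n)
  show ?case
  proof (cases "n = 0")
    case True
    then show ?thesis using less.prems by simp
  next
    case False
    have "\<exists>i<n. coeff (perp (elementary_sym i) (complete_perp (n - i) f)) M \<noteq> 0"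
    proof (rule ccontr)
      assume none: "\<not> ?thesis"
      have "0 = coeff (\<Sum>i\<le>n. (- 1) ^ i * perp (elementary_sym i) (complete_perp (n - i) f)) M"
        using False by (simp add: sum_elementary_complete_perp)
      \<comment> \<open>If all terms with i < n vanish at M, the term i = n, which is e_n^perp f up
        to sign, must vanish too.\<close>
      also have "\<dots> = (\<Sum>i\<le>n. if i = n then (- 1) ^ n * coeff (perp (elementary_sym n) (complete_perp 0 f)) M else 0)"
        unfolding coeff_sum using none by (intro sum.cong) (auto simp: le_less)
      also have "complete_perp 0 f = f"
        by (rule symfun_eqI) (simp add: complete_perp.rep_eq)
      finally show False using less.prems(2) by simp
    qed
    then obtain i where i: "i < n" "coeff (perp (elementary_sym i) (complete_perp (n - i) f)) M \<noteq> 0"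
      by blast
    have "size N + (s + (n - i)) \<le> d" if "coeff (complete_perp (n - i) f) N \<noteq> 0" for N
      using less.prems(1)[of "N + replicate_mset (n - i) (SOME j. j \<notin># N)"] that
      by (simp add: complete_perp.rep_eq)
    from less.IH[OF i(1) this i(2)] i(1) show ?thesis by simp
  qed
qed

lemma elementary_part_empty [simp]: "elementary_part {#} = 1"
  by (simp add: elementary_part_def)

lemma elementary_part_add_mset: "elementary_part (add_mset n \<mu>) = elementary_sym n * elementary_part \<mu>"
  by (simp add: elementary_part_def)

lemma perp_elementary_part_degree:
  assumes "\<And>M. coeff f M \<noteq> 0 \<Longrightarrow> size M + s \<le> d" and "coeff (perp (elementary_part \<mu>) f) M \<noteq> 0"
  shows "size M + (s + sum_mset \<mu>) \<le> d"
  using assms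
proof (induction \<mu> arbitrary: f s)
  case (add n \<mu>)
  have "size M + ((s + n) + sum_mset \<mu>) \<le> d"
    by (rule add.IH[of "perp (elementary_sym n) f"])
       (use perp_elementary_sym_degree[of f s d n] add.prems in
          \<open>auto simp: elementary_part_add_mset perp_mult\<close>)
  then show ?case by (simp add: add.assoc)
qed simp

section \<open>The coefficients of the column-adding operator\<close>

text \<open>
  The coefficient of the monomial \<open>M\<close> in \<open>f[X - Y]\<close> for \<open>Y = {x\<^sub>j | j \<in> T}\<close>: the variables in \<open>Y\<close> are set to \<open>0\<close>.
\<close>

lemma sum_perp_elementary_part:
  fixes f :: "'a :: field_char_0 symfun"
  assumes "finite T"
  shows "(\<Sum>A | A \<subseteq># M \<and> set_mset A \<subseteq> T.
      (- 1) ^ size A * coeff (perp (elementary_part (exponents A)) f) (M - A)) =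
    (if set_mset M \<inter> T = {} then coeff f M else 0)"
  using assms
proof (induction T arbitrary: M rule: finite_induct)
  case empty
  have "{A. A \<subseteq># M \<and> set_mset A \<subseteq> {}} = {{#}}" by auto
  then show ?case by simp
next
  case (insert j T)
  define m where "m = count M j"
  define M\<^sub>0 where "M\<^sub>0 = filter_mset (\<lambda>i. i \<noteq> j) M"
  have M: "M = M\<^sub>0 + replicate_mset m j"
    by (rule multiset_eqI) (simp add: M\<^sub>0_def m_def)
  have j: "j \<notin># M\<^sub>0" by (simp add: M\<^sub>0_def)
  define S where "S = {A. A \<subseteq># M\<^sub>0 \<and> set_mset A \<subseteq> T}"
  have jS: "j \<notin># A" if "A \<in> S" for A using that insert.hyps(2) by (auto simp: S_def)
  \<comment> \<open>For fixed \<open>A\<close> away from x_j, an exponent i of x_j in the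
    submonomial contributes the factor e_i, and the remaining x_j^(m-i) is a power of a fresh
    variable, hence h_(m-i)^perp. The sum over i is E(-t) H(t) = 1 applied to
    \<open>perp (elementary_part (exponents A)) f\<close>, so it is 0 unless x_j is absent from
    M.\<close>
  have step: "(\<Sum>i\<le>m. (- 1) ^ size (A + replicate_mset i j) *
        coeff (perp (elementary_part (exponents (A + replicate_mset i j))) f) (M - (A + replicate_mset i j))) =
      (if m = 0 then (- 1) ^ size A * coeff (perp (elementary_part (exponents A)) f) (M\<^sub>0 - A) else 0)"
    if A: "A \<in> S" for A
  proof -
    define g where "g = perp (elementary_part (exponents A)) f"
    have "(- 1) ^ size (A + replicate_mset i j) *
          coeff (perp (elementary_part (exponents (A + replicate_mset i j))) f) (M - (A + replicate_mset i j)) =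
        (- 1) ^ size A * coeff ((- 1) ^ i * complete_perp (m - i) (perp (elementary_sym i) g)) (M\<^sub>0 - A)"
      if i: "i \<in> {..m}" for i
    proof -
      have "elementary_part (exponents (A + replicate_mset i j)) =
          elementary_part (exponents A) * (elementary_sym i :: 'a symfun)"
        using jS[OF A] by (cases "i = 0") (simp_all add: exponents_plus_replicate elementary_part_add_mset mult.commute)
      moreover have "M - (A + replicate_mset i j) = (M\<^sub>0 - A) + replicate_mset (m - i) j"
      proof (rule multiset_eqI)
        fix x
        have "count A x \<le> count M\<^sub>0 x" using A by (simp add: S_def mset_subset_eq_count)
        then show "count (M - (A + replicate_mset i j)) x = count (M\<^sub>0 - A + replicate_mset (m - i) j) x"
          using i jS[OF A] j by (auto simp: M not_in_iff)
      qed
      moreover have "j \<notin># M\<^sub>0 - A" using j in_diffD by metis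
      ultimately show ?thesis
        by (simp add: perp_mult g_def coeff_complete_perp power_add mult.assoc)
    qed
    then have "(\<Sum>i\<le>m. (- 1) ^ size (A + replicate_mset i j) *
          coeff (perp (elementary_part (exponents (A + replicate_mset i j))) f) (M - (A + replicate_mset i j))) =
        (- 1) ^ size A * coeff (\<Sum>i\<le>m. (- 1) ^ i * complete_perp (m - i) (perp (elementary_sym i) g)) (M\<^sub>0 - A)"
      unfolding coeff_sum sum_distrib_left by (intro sum.cong refl)
    then show ?thesis
      by (simp add: sum_complete_perp_elementary g_def)
  qed
  have "(\<Sum>A | A \<subseteq># M \<and> set_mset A \<subseteq> insert j T.
      (- 1) ^ size A * coeff (perp (elementary_part (exponents A)) f) (M - A)) =
    (\<Sum>(A, i)\<in>S \<times> {..m}. (- 1) ^ size (A + replicate_mset i j) *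
        coeff (perp (elementary_part (exponents (A + replicate_mset i j))) f) (M - (A + replicate_mset i j)))"
  proof (rule sum.reindex_bij_witness[where i = "\<lambda>(A, i). A + replicate_mset i j"
        and j = "\<lambda>A. (filter_mset (\<lambda>i. i \<noteq> j) A, count A j)"])
    fix A assume A: "A \<in> {A. A \<subseteq># M \<and> set_mset A \<subseteq> insert j T}"
    have recombine: "filter_mset (\<lambda>i. i \<noteq> j) A + replicate_mset (count A j) j = A"
      by (rule multiset_eqI) simp
    then show "(case (filter_mset (\<lambda>i. i \<noteq> j) A, count A j) of (A, i) \<Rightarrow> A + replicate_mset i j) = A"
      by simp
    show "(filter_mset (\<lambda>i. i \<noteq> j) A, count A j) \<in> S \<times> {..m}"
      using A by (auto simp: S_def M\<^sub>0_def m_def mset_subset_eq_count multiset_filter_mono)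
    show "(case (filter_mset (\<lambda>i. i \<noteq> j) A, count A j) of (A, i) \<Rightarrow>
        (- 1) ^ size (A + replicate_mset i j) *
        coeff (perp (elementary_part (exponents (A + replicate_mset i j))) f) (M - (A + replicate_mset i j))) =
      (- 1) ^ size A * coeff (perp (elementary_part (exponents A)) f) (M - A)"
      by (simp add: recombine del: size_union)
  next
    fix p assume "p \<in> S \<times> {..m}"
    then obtain A i where p: "p = (A, i)" "A \<in> S" "i \<le> m" by auto
    have "filter_mset (\<lambda>i. i \<noteq> j) A = A" using jS[OF p(2)] by (auto simp: filter_mset_eq_conv)
    then show "(filter_mset (\<lambda>i. i \<noteq> j) (case p of (A, i) \<Rightarrow> A + replicate_mset i j),
        count (case p of (A, i) \<Rightarrow> A + replicate_mset i j) j) = p"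
      using jS[OF p(2)] by (simp add: p(1) not_in_iff)
    have "A + replicate_mset i j \<subseteq># M"
      unfolding M using p(2,3) by (intro subset_mset.add_mono) (auto simp: S_def count_le_replicate_mset_subset_eq[symmetric])
    then show "(case p of (A, i) \<Rightarrow> A + replicate_mset i j) \<in> {A. A \<subseteq># M \<and> set_mset A \<subseteq> insert j T}"
      using p(2) by (auto simp: p(1) S_def split: if_splits)
  qed
  also have "\<dots> = (\<Sum>A\<in>S. \<Sum>i\<le>m. (- 1) ^ size (A + replicate_mset i j) *
        coeff (perp (elementary_part (exponents (A + replicate_mset i j))) f) (M - (A + replicate_mset i j)))"
    by (rule sum.cartesian_product[symmetric])
  also have "\<dots> = (\<Sum>A\<in>S. if m = 0 then (- 1) ^ size A * coeff (perp (elementary_part (exponents A)) f) (M\<^sub>0 - A) else 0)"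
    by (rule sum.cong[OF refl step])
  also have "\<dots> = (if set_mset M \<inter> insert j T = {} then coeff f M else 0)"
  proof (cases "m = 0")
    case True
    then have "j \<notin># M" by (simp add: m_def not_in_iff)
    moreover have "M\<^sub>0 = M" using M unfolding True by simp
    ultimately show ?thesis using True insert.IH[of M] by (simp add: S_def)
  next
    case False
    then have "j \<in># M" by (simp add: m_def not_in_iff)
    then show ?thesis using False by auto
  qed
  finally show ?case .
qed

lemma exponents_plus_repeat:
  assumes "finite S" and "set_mset A \<inter> S = {}" and "a > 0"
  shows "exponents (A + repeat_mset a (mset_set S)) = insert_parts a (card S) (exponents A)"
proof -
  have S: "set_mset (repeat_mset a (mset_set S)) = S"
    using assms by (auto simp: count_mset_set' simp flip: count_greater_zero_iff)
  have "image_mset (count (repeat_mset a (mset_set S))) (mset_set S) = image_mset (\<lambda>_. a) (mset_set S)"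
    using assms(1) by (intro image_mset_cong) auto
  then have "exponents (repeat_mset a (mset_set S)) = replicate_mset (card S) a"
    unfolding exponents_def S by (simp add: image_mset_const_eq)
  then show ?thesis
    using assms(2) S by (simp add: exponents_plus_disjoint insert_parts_def)
qed

text \<open>
  The binomial coefficient \<open>(n\<^sub>a(\<mu>) + k choose k)\<close> counts the ways to choose the \<open>k\<close> inserted
  parts \<open>a\<close> among all parts \<open>a\<close> of \<open>\<mu> + (a\<^sup>k)\<close>, that is, to choose \<open>k\<close> variables with exponent \<open>a\<close>.
\<close>

lemma sum_insert_parts:
  fixes F :: "nat multiset \<Rightarrow> 'b :: comm_ring_1"
  assumes "a > 0" and "size A \<le> d"
  shows "(\<Sum>\<mu> | is_partition \<mu> \<and> sum_mset \<mu> \<le> d.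
      if exponents A = insert_parts a k \<mu>
      then (- 1) ^ sum_mset \<mu> * of_nat ((count \<mu> a + k) choose k) * F \<mu> else 0) =
    (\<Sum>S | S \<subseteq> {i. i \<in># A \<and> count A i = a} \<and> card S = k.
      (- 1) ^ size (A - repeat_mset a (mset_set S)) * F (exponents (A - repeat_mset a (mset_set S))))"
proof -
  define C where "C = {i. i \<in># A \<and> count A i = a}"
  have "finite C" by (simp add: C_def)
  have count: "count (exponents A) a = card C" by (simp add: count_exponents C_def)
  have sub: "exponents A = insert_parts a k (exponents (A - repeat_mset a (mset_set S))) \<and>
      size (A - repeat_mset a (mset_set S)) \<le> size A" if S: "S \<subseteq> C" "card S = k" for S
  proof -
    have fin: "finite S" using S \<open>finite C\<close> finite_subset by blast
    have le: "repeat_mset a (mset_set S) \<subseteq># A"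
      using S fin by (auto simp: subseteq_mset_def C_def count_mset_set')
    have disj: "set_mset (A - repeat_mset a (mset_set S)) \<inter> S = {}"
      using S fin by (auto simp: C_def in_diff_count)
    have "A = (A - repeat_mset a (mset_set S)) + repeat_mset a (mset_set S)" using le by simp
    then show ?thesis
      using exponents_plus_repeat[OF fin disj assms(1)] S(2) by (metis le_add1 size_union)
  qed
  \<comment> \<open>Inserting parts is cancellative, so this is the only candidate for \<mu>, and
    every S gives the same summand \<open>t\<close>. If fewer than k variables have exponent a, the
    truncated difference means nothing, but then both sides are 0.\<close>
  define \<mu>\<^sub>0 where "\<mu>\<^sub>0 = exponents A - replicate_mset k a"
  define t where "t = (- 1) ^ sum_mset \<mu>\<^sub>0 * F \<mu>\<^sub>0"
  have "(\<Sum>S | S \<subseteq> C \<and> card S = k.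
      (- 1) ^ size (A - repeat_mset a (mset_set S)) * F (exponents (A - repeat_mset a (mset_set S)))) =
    (\<Sum>S | S \<subseteq> C \<and> card S = k. t)"
  proof (intro sum.cong refl)
    fix S assume "S \<in> {S. S \<subseteq> C \<and> card S = k}"
    then have "exponents (A - repeat_mset a (mset_set S)) = \<mu>\<^sub>0"
      using sub[of S] by (simp add: \<mu>\<^sub>0_def insert_parts_def)
    then show "(- 1) ^ size (A - repeat_mset a (mset_set S)) * F (exponents (A - repeat_mset a (mset_set S))) = t"
      by (simp add: t_def size_eq_sum_exponents)
  qed
  also have "\<dots> = of_nat (card C choose k) * t"
    using n_subsets[OF \<open>finite C\<close>, of k] by simp
  also have "\<dots> = (\<Sum>\<mu> | is_partition \<mu> \<and> sum_mset \<mu> \<le> d.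
      if exponents A = insert_parts a k \<mu>
      then (- 1) ^ sum_mset \<mu> * of_nat ((count \<mu> a + k) choose k) * F \<mu> else 0)"
  proof (cases "k \<le> card C")
    case True
    then have "replicate_mset k a \<subseteq># exponents A"
      using count by (simp flip: count_le_replicate_mset_subset_eq)
    then have A: "exponents A = insert_parts a k \<mu>\<^sub>0"
      by (simp add: \<mu>\<^sub>0_def insert_parts_def)
    have iff: "exponents A = insert_parts a k \<mu> \<longleftrightarrow> \<mu> = \<mu>\<^sub>0" for \<mu>
      unfolding A by (auto simp: insert_parts_def)
    have "is_partition \<mu>\<^sub>0"
      using is_partition_exponents[of A] by (auto simp: A insert_parts_def is_partition_def)
    moreover have "sum_mset \<mu>\<^sub>0 \<le> d"
      using assms(2) by (simp add: size_eq_sum_exponents A insert_parts_def)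
    moreover have "count \<mu>\<^sub>0 a + k = card C"
      using count by (simp add: A insert_parts_def)
    ultimately show ?thesis
      using finite_partitions[of d] unfolding iff by (simp add: t_def mult_ac)
  next
    case False
    have "exponents A \<noteq> insert_parts a k \<mu>" for \<mu>
    proof
      assume "exponents A = insert_parts a k \<mu>"
      then show False using count False by (simp add: insert_parts_def)
    qed
    then show ?thesis using False by (simp add: binomial_eq_0)
  qed
  finally show ?thesis unfolding C_def by (rule sym)
qed

text \<open>A submonomial A of M of type \<mu> + (a^k), with k of its variables of exponent a chosen
  as S, splits as (\<Prod>S)^a B with B free of S. For fixed S the signed sum over B sets the
  variables of M outside S to 0, so it vanishes unless S contains them all. By
  \<open>size M \<le> d\<close> the truncated sum over \<mu> contains the type of every such
  B.\<close>

lemma sum_coeff_CM_term: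
  fixes f :: "'a :: field_char_0 symfun"
  assumes "a > 0" and "size M \<le> d"
  shows "(\<Sum>\<mu> | is_partition \<mu> \<and> sum_mset \<mu> \<le> d. coeff (CM_term a k \<mu> f) M) =
    (if card (set_mset M) = k \<and> (\<forall>i\<in>#M. a \<le> count M i)
     then coeff f (M - repeat_mset a (mset_set (set_mset M))) else 0)"
proof -
  define \<Lambda> where "\<Lambda> = {\<mu>. is_partition \<mu> \<and> sum_mset \<mu> \<le> d}"
  define F where "F A \<mu> = coeff (perp (elementary_part \<mu>) f) (M - A)" for A \<mu>
  define R where "R S = repeat_mset a (mset_set S)" for S :: "nat set"
  define \<S> where "\<S> A = {S. S \<subseteq> {i. i \<in># A \<and> count A i = a} \<and> card S = k}" for A :: "nat multiset"
  define \<T> where "\<T> = {S. S \<subseteq> {i. i \<in># M \<and> a \<le> count M i} \<and> card S = k}"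
  define \<A> where "\<A> S = {A. A \<subseteq># M - R S \<and> set_mset A \<subseteq> set_mset M - S}" for S
  have count_R: "count (R S) i = (if i \<in> S then a else 0)" if "finite S" for S i
    using that by (simp add: R_def count_mset_set')
  have finS: "finite S" if "S \<in> \<S> A" for S A
    using that by (auto simp: \<S>_def intro: finite_subset[of _ "set_mset A"])
  have finT: "finite S" if "S \<in> \<T>" for S
    using that by (auto simp: \<T>_def intro: finite_subset[of _ "set_mset M"])
  have fin\<S>: "finite (\<S> A)" for A
    by (rule finite_subset[of _ "Pow (set_mset A)"]) (auto simp: \<S>_def)
  have fin\<T>: "finite \<T>"
    by (rule finite_subset[of _ "Pow (set_mset M)"]) (auto simp: \<T>_def)
  have fin\<A>: "finite (\<A> S)" for S
    by (rule finite_subset[OF _ finite_submultisets[of "M - R S"]]) (auto simp: \<A>_def)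
  have "coeff (CM_term a k \<mu> f) M = (\<Sum>A | A \<subseteq># M. if exponents A = insert_parts a k \<mu>
      then (- 1) ^ sum_mset \<mu> * of_nat ((count \<mu> a + k) choose k) * F A \<mu> else 0)" for \<mu>
    unfolding CM_term_def mult.assoc coeff_minus_one_power_mult coeff_of_nat_mult coeff_times[of "monomial_sym _"]
      sum_distrib_left
    by (intro sum.cong) (auto simp: coeff_monomial F_def)
  then have "(\<Sum>\<mu>\<in>\<Lambda>. coeff (CM_term a k \<mu> f) M) =
      (\<Sum>\<mu>\<in>\<Lambda>. \<Sum>A | A \<subseteq># M. if exponents A = insert_parts a k \<mu>
        then (- 1) ^ sum_mset \<mu> * of_nat ((count \<mu> a + k) choose k) * F A \<mu> else 0)"
    by simp
  also have "\<dots> = (\<Sum>A | A \<subseteq># M. \<Sum>\<mu>\<in>\<Lambda>. if exponents A = insert_parts a k \<mu>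
        then (- 1) ^ sum_mset \<mu> * of_nat ((count \<mu> a + k) choose k) * F A \<mu> else 0)"
    by (rule sum.swap)
  also have "\<dots> = (\<Sum>A | A \<subseteq># M. \<Sum>S\<in>\<S> A. (- 1) ^ size (A - R S) * F A (exponents (A - R S)))"
  proof (intro sum.cong refl)
    fix A assume "A \<in> {A. A \<subseteq># M}"
    then have "size A \<le> d" using assms(2) size_mset_mono[of A M] by simp
    then show "(\<Sum>\<mu>\<in>\<Lambda>. if exponents A = insert_parts a k \<mu>
        then (- 1) ^ sum_mset \<mu> * of_nat ((count \<mu> a + k) choose k) * F A \<mu> else 0) =
        (\<Sum>S\<in>\<S> A. (- 1) ^ size (A - R S) * F A (exponents (A - R S)))"
      unfolding \<Lambda>_def \<S>_def R_def by (rule sum_insert_parts[OF assms(1)])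
  qed
  also have "\<dots> = (\<Sum>(A, S)\<in>Sigma {A. A \<subseteq># M} \<S>. (- 1) ^ size (A - R S) * F A (exponents (A - R S)))"
    by (rule sum.Sigma) (auto simp: finite_submultisets fin\<S>)
  also have "\<dots> = (\<Sum>(S, A)\<in>Sigma \<T> \<A>. (- 1) ^ size A * F (A + R S) (exponents A))"
  proof (rule sum.reindex_bij_witness[where i = "\<lambda>(S, A). (A + R S, S)" and j = "\<lambda>(A, S). (S, A - R S)"])
    fix p assume "p \<in> Sigma {A. A \<subseteq># M} \<S>"
    then obtain A S where p: "p = (A, S)" and A: "A \<subseteq># M" and S: "S \<in> \<S> A" by auto
    have le: "R S \<subseteq># A"
      using S by (auto simp: subseteq_mset_def count_R[OF finS[OF S]] \<S>_def)
    then have add: "A - R S + R S = A" by simp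
    then show "(case case p of (A, S) \<Rightarrow> (S, A - R S) of (S, A) \<Rightarrow> (A + R S, S)) = p"
      by (simp add: p)
    show "(case case p of (A, S) \<Rightarrow> (S, A - R S) of (S, A) \<Rightarrow> (- 1) ^ size A * F (A + R S) (exponents A)) =
        (case p of (A, S) \<Rightarrow> (- 1) ^ size (A - R S) * F A (exponents (A - R S)))"
      by (simp add: p add)
    have countA: "count A i \<le> count M i" for i using A by (rule mset_subset_eq_count)
    have "S \<in> \<T>"
      using S A countA mset_subset_eqD[OF A] by (fastforce simp: \<S>_def \<T>_def)
    moreover have "A - R S \<subseteq># M - R S"
      using countA by (auto simp: subseteq_mset_def diff_le_mono)
    moreover have "set_mset (A - R S) \<subseteq> set_mset M - S"
      using S mset_subset_eqD[OF A] in_diffD[of _ A "R S"]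
      by (auto simp: \<S>_def in_diff_count[of _ A] count_R[OF finS[OF S]])
    ultimately show "(case p of (A, S) \<Rightarrow> (S, A - R S)) \<in> Sigma \<T> \<A>"
      by (simp add: p \<A>_def)
  next
    fix p assume "p \<in> Sigma \<T> \<A>"
    then obtain S A where p: "p = (S, A)" and S: "S \<in> \<T>" and A: "A \<in> \<A> S" by auto
    show "(case case p of (S, A) \<Rightarrow> (A + R S, S) of (A, S) \<Rightarrow> (S, A - R S)) = p"
      by (simp add: p)
    have "R S \<subseteq># M"
      using S by (auto simp: subseteq_mset_def count_R[OF finT[OF S]] \<T>_def)
    then have "A + R S \<subseteq># M"
      using A by (auto simp: \<A>_def subset_mset.le_diff_conv2)
    moreover have "S \<in> \<S> (A + R S)"
    proof -
      have count: "count (A + R S) i = a" if "i \<in> S" for i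
        using that A finT[OF S] by (auto simp: \<A>_def count_R not_in_iff)
      then have "i \<in># A + R S" if "i \<in> S" for i
        using that assms(1) by (metis count_greater_zero_iff)
      with count show ?thesis
        using S by (auto simp: \<S>_def \<T>_def simp del: set_mset_union count_union)
    qed
    ultimately show "(case p of (S, A) \<Rightarrow> (A + R S, S)) \<in> Sigma {A. A \<subseteq># M} \<S>"
      by (simp add: p)
  qed
  also have "\<dots> = (\<Sum>S\<in>\<T>. \<Sum>A\<in>\<A> S. (- 1) ^ size A * F (A + R S) (exponents A))"
    by (rule sum.Sigma[symmetric]) (auto simp: fin\<T> fin\<A>)
  also have "\<dots> = (\<Sum>S\<in>\<T>. if S = set_mset M then coeff f (M - R S) else 0)"
  proof (intro sum.cong refl)
    fix S assume S: "S \<in> \<T>"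
    have "F (A + R S) \<mu> = coeff (perp (elementary_part \<mu>) f) ((M - R S) - A)" for A \<mu>
      by (simp add: F_def add.commute)
    then have "(\<Sum>A\<in>\<A> S. (- 1) ^ size A * F (A + R S) (exponents A)) =
        (if set_mset (M - R S) \<inter> (set_mset M - S) = {} then coeff f (M - R S) else 0)"
      using sum_perp_elementary_part[where T = "set_mset M - S" and M = "M - R S" and f = f] by (simp add: \<A>_def)
    \<comment> \<open>Removing (\<Prod>S)^a leaves the exponents outside S untouched, so the
      intersection is empty only if S exhausts the variables of M.\<close>
    moreover have "set_mset (M - R S) \<inter> (set_mset M - S) = set_mset M - S"
      by (auto simp: in_diff_count count_R[OF finT[OF S]])
    moreover have "S \<subseteq> set_mset M" using S by (auto simp: \<T>_def)
    ultimately show "(\<Sum>A\<in>\<A> S. (- 1) ^ size A * F (A + R S) (exponents A)) =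
        (if S = set_mset M then coeff f (M - R S) else 0)"
      by auto
  qed
  also have "\<dots> = (if set_mset M \<in> \<T> then coeff f (M - R (set_mset M)) else 0)"
    using fin\<T> by simp
  also have "set_mset M \<in> \<T> \<longleftrightarrow> card (set_mset M) = k \<and> (\<forall>i\<in>#M. a \<le> count M i)"
    by (auto simp: \<T>_def)
  finally show ?thesis unfolding \<Lambda>_def R_def .
qed

text \<open>Taking a off every exponent of M undoes the added columns. A variable of exponent
  exactly a disappears from \<open>M'\<close>; such variables are the zeros with which \<nu> is
  padded.\<close>

lemma exponents_eq_add_columns_iff:
  assumes "a > 0" and "is_partition \<nu>"
  shows "size \<nu> \<le> k \<and> exponents M = add_columns a k \<nu> \<longleftrightarrow>
    card (set_mset M) = k \<and> (\<forall>i\<in>#M. a \<le> count M i) \<and>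
      exponents (M - repeat_mset a (mset_set (set_mset M))) = \<nu>"
proof -
  define M' where "M' = M - repeat_mset a (mset_set (set_mset M))"
  have count_M': "count M' i = count M i - a" for i
    by (cases "i \<in># M") (auto simp: M'_def count_mset_set' not_in_iff)
  have "set_mset M' \<subseteq> set_mset M" by (auto simp: M'_def dest: in_diffD)
  then have size_M': "size (exponents M') \<le> card (set_mset M)"
    by (simp add: size_exponents card_mono)
  have M: "exponents M = add_columns a (card (set_mset M)) (exponents M')"
    if ge: "\<forall>i\<in>#M. a \<le> count M i"
  proof -
    have "exponents M = image_mset (\<lambda>i. count M' i + a) (mset_set (set_mset M))"
      unfolding exponents_def using ge by (intro image_mset_cong) (auto simp: count_M')
    also have "\<dots> = image_mset (\<lambda>i. i + a) (image_mset (count M') (mset_set (set_mset M)))"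
      by (simp add: multiset.map_comp comp_def)
    also have "image_mset (count M') (mset_set (set_mset M)) =
        exponents M' + replicate_mset (card (set_mset M) - size (exponents M')) 0"
      using \<open>set_mset M' \<subseteq> set_mset M\<close> by (intro image_mset_count_superset) auto
    finally show ?thesis by (simp add: add_columns_def)
  qed
  show ?thesis
    unfolding M'_def[symmetric]
  proof (intro iffI conjI; (elim conjE)?)
    assume k: "size \<nu> \<le> k" and eq: "exponents M = add_columns a k \<nu>"
    have "size (exponents M) = k" unfolding eq using k by (simp add: add_columns_def)
    then show card: "card (set_mset M) = k" by (simp add: size_exponents)
    have "a \<le> n" if "n \<in># exponents M" for n using that unfolding eq by (auto simp: add_columns_def split: if_splits)
    then show ge: "\<forall>i\<in>#M. a \<le> count M i" by (auto simp: exponents_def)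
    have "add_columns a k (exponents M') = add_columns a k \<nu>" using M[OF ge] eq card by simp
    then have "exponents M' + replicate_mset (k - size (exponents M')) 0 = \<nu> + replicate_mset (k - size \<nu>) 0"
      using arg_cong[of "add_columns a k (exponents M')" "add_columns a k \<nu>" "image_mset (\<lambda>i. i - a)"]
      unfolding add_columns_def multiset.map_comp comp_def by simp
    \<comment> \<open>A partition has no part 0, so deleting zeros undoes the padding.\<close>
    then have "filter_mset (\<lambda>i. i \<noteq> 0) (exponents M' + replicate_mset (k - size (exponents M')) 0) =
        filter_mset (\<lambda>i. i \<noteq> 0) (\<nu> + replicate_mset (k - size \<nu>) 0)" by simp
    moreover have "filter_mset (\<lambda>i. i \<noteq> 0) (\<kappa> + replicate_mset n 0) = \<kappa>" if "is_partition \<kappa>" for \<kappa> n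
      using that by (auto simp: is_partition_def filter_mset_eq_conv multiset_eq_iff not_in_iff)
    ultimately show "exponents M' = \<nu>" using assms(2) is_partition_exponents by metis
  next
    assume "card (set_mset M) = k" "\<forall>i\<in>#M. a \<le> count M i" "exponents M' = \<nu>"
    then show "size \<nu> \<le> k" "exponents M = add_columns a k \<nu>" using M size_M' by auto
  qed
qed

text \<open>e_\<mu>^perp lowers the degree by |\<mu>|, so nothing is left of f. This gives the
  finiteness of the sum defining \<open>CM\<close>.\<close>

lemma CM_term_eq_0:
  assumes "\<And>M. coeff f M \<noteq> 0 \<Longrightarrow> size M \<le> d" and "d < sum_mset \<mu>"
  shows "CM_term a k \<mu> f = 0"
proof -
  have "coeff (perp (elementary_part \<mu>) f) M = 0" for M
    using perp_elementary_part_degree[of f 0 d \<mu> M] assms by force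
  then have "perp (elementary_part \<mu>) f = 0" by (intro symfun_eqI) simp
  then show ?thesis by (simp add: CM_term_def)
qed

theorem mainTheorem14:
  fixes a k :: nat and \<nu> :: "nat multiset"
  assumes "a > 0" and "is_partition \<nu>"
  shows "finite {\<mu>. is_partition \<mu> \<and> CM_term a k \<mu> (monomial_sym \<nu> :: 'a :: field_char_0 symfun) \<noteq> 0} \<and>
         CM a k (monomial_sym \<nu> :: 'a symfun) =
           (if size \<nu> \<le> k then monomial_sym (add_columns a k \<nu>) else 0)"
proof
  define f :: "'a symfun" where "f = monomial_sym \<nu>"
  have "size M \<le> sum_mset \<nu>" if "coeff f M \<noteq> 0" for M
    using that by (auto simp: f_def coeff_monomial size_eq_sum_exponents split: if_splits)
  then have zero: "CM_term a k \<mu> f = 0" if "sum_mset \<nu> < sum_mset \<mu>" for \<mu>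
    using CM_term_eq_0[of f] that by blast
  have sub: "{\<mu>. is_partition \<mu> \<and> CM_term a k \<mu> f \<noteq> 0} \<subseteq> {\<mu>. is_partition \<mu> \<and> sum_mset \<mu> \<le> d}"
    if "sum_mset \<nu> \<le> d" for d
    using zero that by (force simp: not_less[symmetric])
  show "finite {\<mu>. is_partition \<mu> \<and> CM_term a k \<mu> (monomial_sym \<nu> :: 'a symfun) \<noteq> 0}"
    using finite_subset[OF sub[OF order_refl] finite_partitions] by (simp add: f_def)
  show "CM a k (monomial_sym \<nu> :: 'a symfun) = (if size \<nu> \<le> k then monomial_sym (add_columns a k \<nu>) else 0)"
  proof (rule symfun_eqI)
    fix M :: "nat multiset"
    \<comment> \<open>At least |\<nu>|, so that all terms left out vanish, and at least the degree
      of M, as the coefficient formula requires.\<close>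
    define d where "d = max (sum_mset \<nu>) (size M)"
    have "coeff (CM a k f) M = (\<Sum>\<mu> | is_partition \<mu> \<and> CM_term a k \<mu> f \<noteq> 0. coeff (CM_term a k \<mu> f) M)"
      by (simp add: CM_def)
    also have "\<dots> = (\<Sum>\<mu> | is_partition \<mu> \<and> sum_mset \<mu> \<le> d. coeff (CM_term a k \<mu> f) M)"
      using sub[of d] by (intro sum.mono_neutral_left finite_partitions) (auto simp: d_def)
    also have "\<dots> = (if card (set_mset M) = k \<and> (\<forall>i\<in>#M. a \<le> count M i)
        then coeff f (M - repeat_mset a (mset_set (set_mset M))) else 0)"
      by (rule sum_coeff_CM_term[OF assms(1)]) (simp add: d_def)
    also have "\<dots> = (if size \<nu> \<le> k \<and> exponents M = add_columns a k \<nu> then 1 else 0)"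
      unfolding exponents_eq_add_columns_iff[OF assms] by (auto simp: f_def coeff_monomial)
    finally show "coeff (CM a k (monomial_sym \<nu> :: 'a symfun)) M =
        coeff (if size \<nu> \<le> k then monomial_sym (add_columns a k \<nu>) else 0) M"
      by (auto simp: f_def coeff_monomial)
  qed
qed

end
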